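(* Let $\varepsilon\in(0,1)$. Under the conditions $d_i=d$ for all $i$, $\kappa\le d\le\eta\log n$ and $p_{\max}\le n^{-1+\eta}$, for all $k\in[n^{1-\varepsilon}]$, $$D_k^{\downarrow}\sim L_k.$$
   Context: Setting: $G$ is a random undirected graph on the vertex set $\{1,\dots,n\}$ (loops allowed) in which each edge $\{i,j\}$ (including $i=j$) is present with probability $p_{ij}=p_{ji}\in[0,1]$, independently of the others; $A$ is its adjacency matrix. Set $p_{\max}=\max_{i\ne j}p_{ij}$, $d_i=\sum_j p_{ij}$, $d=\max_i d_i$. The degree of $i$ is $D_i=\sum_j A_{ij}$, and $D_1^{\downarrow}\ge\dots\ge D_n^{\downarrow}$ are the degrees in decreasing order. For $x>0$, $[x]=\{1,2,\dots,\lfloor x\rfloor\}$. For $k\in[n]$, $$L_k=\frac{\log(n/k)}{\log((\log n)/d)}.$$ Parameters: $\kappa>0$ and $\eta\in(0,1)$. An admissible error function is a function $\psi(n,\kappa,\eta)$ such that for every $\kappa>0$, $\psi(n,\kappa,\eta)\to0$ as $n\to\infty$ and $\eta\to0$ (joint limit). For two families of random variables $(u_t),(v_t)$, "under a condition $\mathcal A$ on $\kappa,\eta,(p_{ij})$, for all $t$, $u_t\sim v_t$" means: there is an admissible error function $\psi$ such that $$\mathbb P\Bigl(\bigl|\tfrac{v_t}{u_t}-1\bigr|\le\psi(n,\kappa,\eta)\text{ for all }t\Bigr)\ge1-\psi(n,\kappa,\eta)$$ for all $n,\kappa,\eta,(p_{ij})_{i,j\in[n]}$ satisfying $\mathcal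 A$ ($\psi$ may depend on $\varepsilon$, but not on $(p_{ij})$).
   Formalization: Added hypothesis: for every i, the sum of p_ij over j≠i is at least κ/2. Without it the claim fails, since p_max (over i≠j) leaves loops free: p_ii=1, p_ij=0 for i≠j gives all D_i=1 while L_1→∞. *)

theory Defs
  imports "HOL-Probability.Probability"
begin

text \<open>
  Vertices are \<open>1, \<dots>, n\<close>. A graph is encoded by the indicator of its edge set, where the edge
  \<open>{i, j}\<close> (a loop if \<open>i = j\<close>) is represented by the pair \<open>(i, j)\<close> with \<open>i \<le> j\<close>.
\<close>

type_synonym graph = "nat \<times> nat \<Rightarrow> bool"

definition possible_edges :: "nat \<Rightarrow> (nat \<times> nat) set" where
  "possible_edges n = {(i, j). 1 \<le> i \<and> i \<le> j \<and> j \<le> n}"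

definition edge_probabilities :: "nat \<Rightarrow> (nat \<Rightarrow> nat \<Rightarrow> real) \<Rightarrow> bool" where
  "edge_probabilities n p \<longleftrightarrow>
     (\<forall>i\<in>{1..n}. \<forall>j\<in>{1..n}. p i j = p j i \<and> 0 \<le> p i j \<and> p i j \<le> 1)"

definition random_graph :: "nat \<Rightarrow> (nat \<Rightarrow> nat \<Rightarrow> real) \<Rightarrow> graph pmf" where
  "random_graph n p = Pi_pmf (possible_edges n) False (\<lambda>(i, j). bernoulli_pmf (p i j))"

definition adjacency :: "graph \<Rightarrow> nat \<Rightarrow> nat \<Rightarrow> nat" where
  "adjacency G i j = of_bool (G (min i j, max i j))"

definition degree :: "nat \<Rightarrow> graph \<Rightarrow> nat \<Rightarrow> nat" where
  "degree n G i = (\<Sum>j\<in>{1..n}. adjacency G i j)"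

text \<open>The \<open>k\<close>-th largest degree, counted with multiplicity, for \<open>1 \<le> k \<le> n\<close>.\<close>

definition ordered_degree :: "nat \<Rightarrow> graph \<Rightarrow> nat \<Rightarrow> nat" where
  "ordered_degree n G k = rev (sort (map (degree n G) [1..<n + 1])) ! (k - 1)"

definition p_max :: "nat \<Rightarrow> (nat \<Rightarrow> nat \<Rightarrow> real) \<Rightarrow> real" where
  "p_max n p = Max {p i j | i j. i \<in> {1..n} \<and> j \<in> {1..n} \<and> i \<noteq> j}"

definition mean_degree :: "nat \<Rightarrow> (nat \<Rightarrow> nat \<Rightarrow> real) \<Rightarrow> nat \<Rightarrow> real" where
  "mean_degree n p i = (\<Sum>j\<in>{1..n}. p i j)"

definition max_mean_degree :: "nat \<Rightarrow> (nat \<Rightarrow> nat \<Rightarrow> real) \<Rightarrow> real" where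
  "max_mean_degree n p = Max (mean_degree n p ` {1..n})"

text \<open>
  Neither \<open>p_max\<close> nor the bounds on the mean degrees control the loop probabilities \<open>p i i\<close>. If the
  mean degrees came from loops alone (say \<open>p i i = 1\<close> and \<open>p i j = 0\<close> for \<open>i \<noteq> j\<close>, where all degrees
  are 1), the degrees could not grow with \<open>n\<close>. The following quantity serves to exclude this.
\<close>

definition loopless_mean_degree :: "nat \<Rightarrow> (nat \<Rightarrow> nat \<Rightarrow> real) \<Rightarrow> nat \<Rightarrow> real" where
  "loopless_mean_degree n p i = (\<Sum>j\<in>{1..n} - {i}. p i j)"

definition L :: "nat \<Rightarrow> (nat \<Rightarrow> nat \<Rightarrow> real) \<Rightarrow> nat \<Rightarrow> real" where
  "L n p k = ln (real n / real k) / ln (ln (real n) / max_mean_degree n p)"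

definition admissible_error :: "(nat \<Rightarrow> real \<Rightarrow> real \<Rightarrow> real) \<Rightarrow> bool" where
  "admissible_error \<psi> \<longleftrightarrow>
     (\<forall>\<kappa>>0. ((\<lambda>(n, \<eta>). \<psi> n \<kappa> \<eta>) \<longlongrightarrow> 0) (sequentially \<times>\<^sub>F at_right 0))"

text \<open>
  The event that \<open>\<bar>v t / u t - 1\<bar> \<le> \<delta>\<close> for all \<open>t\<close>. For \<open>u t = 0\<close> the convention \<open>x / 0 = 0\<close>
  makes the inequality false as long as \<open>\<delta> < 1\<close>; for \<open>\<delta> \<ge> 1\<close> a lower bound \<open>1 - \<delta>\<close> on the
  probability of the event is trivial anyway.
\<close>

definition close_event ::
  "'t set \<Rightarrow> ('t \<Rightarrow> 'w \<Rightarrow> real) \<Rightarrow> ('t \<Rightarrow> 'w \<Rightarrow> real) \<Rightarrow> real \<Rightarrow> 'w set" where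
  "close_event T u v \<delta> = {\<omega>. \<forall>t\<in>T. \<bar>v t \<omega> / u t \<omega> - 1\<bar> \<le> \<delta>}"

end

theory Submission
  imports Defs "HOL-Real_Asymp.Real_Asymp"
begin

text \<open>
  Write \<open>l = ln n\<close>, \<open>T = l / d \<ge> 1 / \<eta>\<close> and \<open>k = n powr (1 - lam)\<close>, so that \<open>L\<^sub>k = lam * l / ln T\<close>. The
  number of vertices of degree at least \<open>(1 \<plusminus> \<delta>) * L\<^sub>k\<close> is compared with \<open>k\<close>. Above, its
  expectation is much smaller than \<open>k\<close> by a Chernoff bound with the tilt \<open>z = T powr (1 - \<delta> / 4)\<close>.
  Below, a maximal cut leaves a set \<open>S\<close> of at least half of the vertices, each keeping half of its
  mean degree towards the complement of \<open>S\<close>; the degrees into the complement are independent over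
  \<open>S\<close>, and since all edge probabilities are small their tails are bounded below by Poisson tails.
  By monotonicity in \<open>k\<close>, it suffices to treat finitely many values of \<open>lam\<close>.
\<close>

section \<open>Counts in families of independent Bernoulli variables\<close>

lemma expectation_pair_pmf_mult:
  fixes f :: "'a \<Rightarrow> real" and g :: "'b \<Rightarrow> real"
  assumes "finite (set_pmf p)" "finite (set_pmf q)"
  shows "measure_pmf.expectation (pair_pmf p q) (\<lambda>z. f (fst z) * g (snd z)) =
    measure_pmf.expectation p f * measure_pmf.expectation q g"
proof -
  have "measure_pmf.expectation (pair_pmf p q) (\<lambda>z. f (fst z) * g (snd z)) =
     (\<Sum>z\<in>set_pmf p \<times> set_pmf q. f (fst z) * g (snd z) * pmf (pair_pmf p q) z)"
    by (rule integral_measure_pmf_real) (use assms in auto)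
  also have "\<dots> = (\<Sum>(x, y)\<in>set_pmf p \<times> set_pmf q. (f x * pmf p x) * (g y * pmf q y))"
    by (intro sum.cong) (auto simp: pmf_pair)
  also have "\<dots> = (\<Sum>x\<in>set_pmf p. f x * pmf p x) * (\<Sum>y\<in>set_pmf q. g y * pmf q y)"
    by (simp add: sum_product sum.cartesian_product)
  also have "(\<Sum>x\<in>set_pmf p. f x * pmf p x) = measure_pmf.expectation p f"
    by (rule integral_measure_pmf_real [symmetric]) (use assms in auto)
  also have "(\<Sum>x\<in>set_pmf q. g x * pmf q x) = measure_pmf.expectation q g"
    by (rule integral_measure_pmf_real [symmetric]) (use assms in auto)
  finally show ?thesis .
qed

locale bernoulli_family =
  fixes I :: "'e set" and p :: "'e \<Rightarrow> real"
  assumes finite_I: "finite I"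
    and p_nonneg: "e \<in> I \<Longrightarrow> 0 \<le> p e"
    and p_le_1: "e \<in> I \<Longrightarrow> p e \<le> 1"
begin

definition law :: "('e \<Rightarrow> bool) pmf" where
  "law = Pi_pmf I False (\<lambda>e. bernoulli_pmf (p e))"

abbreviation prob :: "('e \<Rightarrow> bool) set \<Rightarrow> real" where
  "prob \<equiv> measure_pmf.prob law"

abbreviation expect :: "(('e \<Rightarrow> bool) \<Rightarrow> real) \<Rightarrow> real" where
  "expect \<equiv> measure_pmf.expectation law"

definition count :: "'e set \<Rightarrow> ('e \<Rightarrow> bool) \<Rightarrow> nat" where
  "count J \<omega> = card {e \<in> J. \<omega> e}"

definition mean :: "'e set \<Rightarrow> real" where
  "mean J = (\<Sum>e\<in>J. p e)"

text \<open>Stands in for measurability with respect to the coordinates in \<open>J\<close>;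
  functions of disjoint sets of coordinates are then independent under the product law.\<close>

definition depends_on :: "(('e \<Rightarrow> bool) \<Rightarrow> 'b) \<Rightarrow> 'e set \<Rightarrow> bool" where
  "depends_on f J \<longleftrightarrow> (\<forall>\<omega> \<omega>'. (\<forall>e\<in>J. \<omega> e = \<omega>' e) \<longrightarrow> f \<omega> = f \<omega>')"

lemma finite_support_Pi:
  assumes "finite J"
  shows "finite (set_pmf (Pi_pmf J False (\<lambda>e. bernoulli_pmf (p e))))"
proof -
  have "finite (PiE_dflt J False (set_pmf \<circ> (\<lambda>e. bernoulli_pmf (p e))))"
    using assms by (intro finite_PiE_dflt) auto
  then show ?thesis
    using set_Pi_pmf [OF assms, of False "\<lambda>e. bernoulli_pmf (p e)"] by simp
qed

lemma finite_support: "finite (set_pmf law)"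
  unfolding law_def using finite_support_Pi finite_I by blast

lemma integrable [simp]: "integrable (measure_pmf law) (f :: _ \<Rightarrow> real)"
  by (rule integrable_measure_pmf_finite [OF finite_support])

lemma expect_mono: "(\<And>\<omega>. f \<omega> \<le> g \<omega>) \<Longrightarrow> expect f \<le> expect g"
  by (rule integral_mono) auto

lemma prob_eq_expect: "prob {\<omega>. Q \<omega>} = expect (\<lambda>\<omega>. of_bool (Q \<omega>))"
proof -
  have "prob {\<omega>. Q \<omega>} = expect (indicator {\<omega>. Q \<omega>})"
    by simp
  also have "\<dots> = expect (\<lambda>\<omega>. of_bool (Q \<omega>))"
    by (rule arg_cong [where f = expect]) (auto simp: indicator_def fun_eq_iff)
  finally show ?thesis .
qed

text \<open>The law is that of a pair of independent families, on \<open>A\<close> and on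
  \<open>I - A\<close>, glued together by \<open>h\<close>. By \<open>depends_on\<close>,
  \<open>f\<close> only sees the first component and \<open>g\<close> only the second.\<close>

lemma expect_mult:
  assumes A: "A \<subseteq> I" and f: "depends_on f A" and g: "depends_on g (I - A)"
  shows "expect (\<lambda>\<omega>. f \<omega> * g \<omega>) = expect f * expect g"
proof -
  define PA where "PA = Pi_pmf A False (\<lambda>e. bernoulli_pmf (p e))"
  define PB where "PB = Pi_pmf (I - A) False (\<lambda>e. bernoulli_pmf (p e))"
  define h :: "('e \<Rightarrow> bool) \<times> ('e \<Rightarrow> bool) \<Rightarrow> 'e \<Rightarrow> bool"
    where "h = (\<lambda>(x, y) e. if e \<in> A then x e else y e)"
  have fin: "finite A" "finite (I - A)"
    using A finite_I finite_subset by auto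
  have law: "law = map_pmf h (pair_pmf PA PB)"
    unfolding law_def PA_def PB_def h_def
    using Pi_pmf_union [of A "I - A" False "\<lambda>e. bernoulli_pmf (p e)"] fin A
    by (simp add: Un_absorb1)
  have fh: "f (h z) = f (fst z)" for z
    by (rule f [unfolded depends_on_def, rule_format]) (auto simp: h_def split: prod.split)
  have gh: "g (h z) = g (snd z)" for z
    by (rule g [unfolded depends_on_def, rule_format]) (auto simp: h_def split: prod.split)
  have "expect f = measure_pmf.expectation PA f"
    by (simp add: law fh)
  moreover have "expect g = measure_pmf.expectation PB g"
    by (simp add: law gh)
  moreover have "expect (\<lambda>\<omega>. f \<omega> * g \<omega>) =
      measure_pmf.expectation PA f * measure_pmf.expectation PB g"
    unfolding law integral_map_pmf fh gh
    by (rule expectation_pair_pmf_mult)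
      (use finite_support_Pi fin in \<open>auto simp: PA_def PB_def\<close>)
  ultimately show ?thesis by simp
qed

lemma depends_on_mono: "depends_on f A \<Longrightarrow> A \<subseteq> B \<Longrightarrow> depends_on f B"
  unfolding depends_on_def by blast

lemma depends_on_count: "depends_on (\<lambda>\<omega>. F (count J \<omega>)) J"
  unfolding depends_on_def
proof (intro allI impI)
  fix \<omega> \<omega>' :: "'e \<Rightarrow> bool" assume "\<forall>e\<in>J. \<omega> e = \<omega>' e"
  then have "{e \<in> J. \<omega> e} = {e \<in> J. \<omega>' e}"
    by auto
  then show "F (count J \<omega>) = F (count J \<omega>')"
    by (simp add: count_def)
qed

text \<open>Induction on \<open>S\<close>: the sets \<open>K i\<close> are disjoint, so the
  remaining product only depends on coordinates outside \<open>K s\<close>, and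
  \<open>expect_mult\<close> splits off the factor of \<open>s\<close>.\<close>

lemma expect_prod:
  assumes "finite S" "\<And>i. i \<in> S \<Longrightarrow> K i \<subseteq> I" "disjoint_family_on K S"
    and "\<And>i. i \<in> S \<Longrightarrow> depends_on (f i) (K i)"
  shows "expect (\<lambda>\<omega>. \<Prod>i\<in>S. f i \<omega>) = (\<Prod>i\<in>S. expect (f i))"
  using assms
proof (induction S)
  case (insert s S)
  have "depends_on (\<lambda>\<omega>. \<Prod>i\<in>S. f i \<omega>) (I - K s)"
    unfolding depends_on_def
  proof (intro allI impI prod.cong refl)
    fix \<omega> \<omega>' :: "'e \<Rightarrow> bool" and i assume *: "\<forall>e\<in>I - K s. \<omega> e = \<omega>' e" "i \<in> S"
    have "K i \<inter> K s = {}"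
      using insert.prems(2) insert.hyps *(2) unfolding disjoint_family_on_def by auto
    then have "\<forall>e\<in>K i. \<omega> e = \<omega>' e"
      using * insert.prems(1) by blast
    then show "f i \<omega> = f i \<omega>'"
      using insert.prems(3) [of i] *(2) unfolding depends_on_def by blast
  qed
  then have "expect (\<lambda>\<omega>. f s \<omega> * (\<Prod>i\<in>S. f i \<omega>)) = expect (f s) * expect (\<lambda>\<omega>. \<Prod>i\<in>S. f i \<omega>)"
    using insert.prems by (intro expect_mult [of "K s"]) auto
  also have "expect (\<lambda>\<omega>. \<Prod>i\<in>S. f i \<omega>) = (\<Prod>i\<in>S. expect (f i))"
    using insert.prems by (intro insert.IH) (auto simp: disjoint_family_on_def)
  finally show ?case
    using insert.hyps by simp
qed simp

lemma expect_component:
  assumes "e \<in> I"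
  shows "expect (\<lambda>\<omega>. F (\<omega> e)) = p e * F True + (1 - p e) * F False"
proof -
  have "expect (\<lambda>\<omega>. F (\<omega> e)) = measure_pmf.expectation (map_pmf (\<lambda>\<omega>. \<omega> e) law) F"
    by simp
  also have "map_pmf (\<lambda>\<omega>. \<omega> e) law = bernoulli_pmf (p e)"
    unfolding law_def using assms by (subst Pi_pmf_component) (auto simp: finite_I)
  also have "measure_pmf.expectation (bernoulli_pmf (p e)) F = p e * F True + (1 - p e) * F False"
    using p_nonneg [OF assms] p_le_1 [OF assms] by simp
  finally show ?thesis .
qed

lemma expect_prod_components:
  assumes "J \<subseteq> I"
  shows "expect (\<lambda>\<omega>. \<Prod>e\<in>J. F e (\<omega> e)) = (\<Prod>e\<in>J. p e * F e True + (1 - p e) * F e False)"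
proof -
  have "expect (\<lambda>\<omega>. \<Prod>e\<in>J. F e (\<omega> e)) = (\<Prod>e\<in>J. expect (\<lambda>\<omega>. F e (\<omega> e)))"
    using assms finite_I finite_subset
    by (intro expect_prod [where K = "\<lambda>e. {e}"]) (auto simp: disjoint_family_on_def depends_on_def)
  also have "\<dots> = (\<Prod>e\<in>J. p e * F e True + (1 - p e) * F e False)"
    using assms by (intro prod.cong) (auto simp: expect_component)
  finally show ?thesis .
qed

section \<open>Tail estimates for a single count\<close>

lemma power_count:
  assumes "finite J"
  shows "z ^ count J \<omega> = (\<Prod>e\<in>J. if \<omega> e then z else (1 :: real))"
  using assms by (simp add: count_def prod.If_cases Int_def)

lemma expect_power_count_le:
  assumes "J \<subseteq> I" "1 \<le> z"
  shows "expect (\<lambda>\<omega>. z ^ count J \<omega>) \<le> exp (mean J * (z - 1))"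
proof -
  have J: "finite J"
    using assms finite_I finite_subset by auto
  have "expect (\<lambda>\<omega>. z ^ count J \<omega>) = (\<Prod>e\<in>J. p e * z + (1 - p e) * 1)"
    unfolding power_count [OF J]
    using expect_prod_components [OF assms(1), of "\<lambda>_ b. if b then z else 1"] by simp
  also have "\<dots> \<le> (\<Prod>e\<in>J. exp (p e * (z - 1)))"
  proof (intro prod_mono conjI)
    fix e assume e: "e \<in> J"
    then show "0 \<le> p e * z + (1 - p e) * 1"
      using assms p_nonneg [of e] p_le_1 [of e] by auto
    have "1 + p e * (z - 1) \<le> exp (p e * (z - 1))"
      by (rule exp_ge_add_one_self)
    then show "p e * z + (1 - p e) * 1 \<le> exp (p e * (z - 1))"
      by (simp add: algebra_simps)
  qed
  also have "\<dots> = exp (mean J * (z - 1))"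
    using J by (simp add: mean_def exp_sum sum_distrib_right)
  finally show ?thesis .
qed

text \<open>Chernoff bound: Markov's inequality for \<open>z ^ count J \<omega>\<close>. The tilt
  \<open>z\<close> stays free, to be chosen according to the level.\<close>

lemma prob_count_ge_le:
  assumes "J \<subseteq> I" "1 \<le> z"
  shows "prob {\<omega>. a \<le> real (count J \<omega>)} \<le> exp (mean J * (z - 1)) * z powr - a"
proof -
  have "prob {\<omega>. a \<le> real (count J \<omega>)} \<le> expect (\<lambda>\<omega>. z powr - a * z ^ count J \<omega>)"
    unfolding prob_eq_expect
  proof (rule expect_mono)
    fix \<omega> :: "'e \<Rightarrow> bool"
    have "1 \<le> z powr - a * z ^ count J \<omega>" if "a \<le> real (count J \<omega>)"
    proof -
      have "1 \<le> z powr (real (count J \<omega>) - a)"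
        using that assms by (simp add: ge_one_powr_ge_zero)
      also have "\<dots> = z powr - a * z ^ count J \<omega>"
        using assms by (simp add: powr_diff powr_realpow powr_minus divide_simps)
      finally show ?thesis .
    qed
    then show "of_bool (a \<le> real (count J \<omega>)) \<le> z powr - a * z ^ count J \<omega>"
      using assms by auto
  qed
  also have "\<dots> = z powr - a * expect (\<lambda>\<omega>. z ^ count J \<omega>)"
    by simp
  also have "\<dots> \<le> z powr - a * exp (mean J * (z - 1))"
    using expect_power_count_le [OF assms] by (intro mult_left_mono) auto
  finally show ?thesis by (simp add: mult.commute)
qed

lemma prob_count_eq_0_ge:
  assumes "J \<subseteq> I" "\<And>e. e \<in> J \<Longrightarrow> p e \<le> 1 / 2"
  shows "exp (- 2 * mean J) \<le> prob {\<omega>. count J \<omega> = 0}"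
proof -
  have J: "finite J"
    using assms finite_I finite_subset by auto
  have "exp (- 2 * mean J) = (\<Prod>e\<in>J. exp (- 2 * p e))"
    using J by (simp add: mean_def exp_sum sum_distrib_left)
  also have "\<dots> \<le> (\<Prod>e\<in>J. p e * 0 + (1 - p e) * 1)"
  proof (intro prod_mono conjI)
    fix e assume e: "e \<in> J"
    have p: "0 \<le> p e" "p e \<le> 1 / 2"
      using assms e p_nonneg by auto
    have "- 2 * p e \<le> - p e - 2 * (p e)\<^sup>2"
      using p mult_left_mono [of "p e" "1 / 2" "p e"] by (simp add: power2_eq_square)
    also have "\<dots> \<le> ln (1 - p e)"
      using p by (rule ln_one_minus_pos_lower_bound)
    finally have "exp (- 2 * p e) \<le> exp (ln (1 - p e))"
      by simp
    then show "exp (- 2 * p e) \<le> p e * 0 + (1 - p e) * 1"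
      using p by simp
  qed simp
  \<comment> \<open>Since \<open>0 ^ 0 = 1\<close>, the generating function at \<open>z = 0\<close>
    is the indicator that the count vanishes.\<close>
  also have "\<dots> = expect (\<lambda>\<omega>. 0 ^ count J \<omega>)"
    unfolding power_count [OF J]
    using expect_prod_components [OF assms(1), of "\<lambda>_ b. if b then 0 else 1"] by simp
  also have "\<dots> = prob {\<omega>. count J \<omega> = 0}"
    unfolding prob_eq_expect by (intro arg_cong [where f = expect]) (auto simp: fun_eq_iff)
  finally show ?thesis .
qed

text \<open>Double counting: on the event that the count is \<open>Suc m\<close>, exactly
  \<open>Suc m\<close> elements \<open>e\<close> of \<open>J\<close> are present, and removing any
  of them leaves the count \<open>m\<close>. The presence of \<open>e\<close> is independent of the
  count over \<open>J - {e}\<close>. This is the recursion behind the Poisson-type lower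
  bound.\<close>

lemma prob_count_eq_Suc:
  assumes "J \<subseteq> I"
  shows "real (Suc m) * prob {\<omega>. count J \<omega> = Suc m} =
    (\<Sum>e\<in>J. p e * prob {\<omega>. count (J - {e}) \<omega> = m})"
proof -
  have J: "finite J"
    using assms finite_I finite_subset by auto
  have split: "count J \<omega> = Suc (count (J - {e}) \<omega>)" if "e \<in> J" "\<omega> e" for e \<omega>
  proof -
    have "{x \<in> J. \<omega> x} = insert e {x \<in> J - {e}. \<omega> x}"
      using that by auto
    then show ?thesis
      using J by (simp add: count_def)
  qed
  have "real (Suc m) * of_bool (count J \<omega> = Suc m) =
      (\<Sum>e\<in>J. of_bool (\<omega> e) * of_bool (count (J - {e}) \<omega> = m))" for \<omega>
  proof -
    have "real (Suc m) * of_bool (count J \<omega> = Suc m) = (\<Sum>e\<in>J. of_bool (\<omega> e) * of_bool (count J \<omega> = Suc m))"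
    proof -
      have "(\<Sum>e\<in>J. of_bool (\<omega> e)) = real (count J \<omega>)"
        using J by (simp add: count_def of_bool_def sum.If_cases Int_def)
      then show ?thesis
        by (simp add: sum_distrib_right [symmetric])
    qed
    also have "\<dots> = (\<Sum>e\<in>J. of_bool (\<omega> e) * of_bool (count (J - {e}) \<omega> = m))"
      using split by (intro sum.cong) auto
    finally show ?thesis .
  qed
  note eq = this
  have "real (Suc m) * prob {\<omega>. count J \<omega> = Suc m} =
      expect (\<lambda>\<omega>. real (Suc m) * of_bool (count J \<omega> = Suc m))"
    unfolding prob_eq_expect by (rule integral_mult_right_zero [symmetric])
  also have "\<dots> = expect (\<lambda>\<omega>. \<Sum>e\<in>J. of_bool (\<omega> e) * of_bool (count (J - {e}) \<omega> = m))"
    unfolding eq ..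
  also have "\<dots> = (\<Sum>e\<in>J. expect (\<lambda>\<omega>. of_bool (\<omega> e) * of_bool (count (J - {e}) \<omega> = m)))"
    by (rule Bochner_Integration.integral_sum) simp
  also have "\<dots> = (\<Sum>e\<in>J. p e * prob {\<omega>. count (J - {e}) \<omega> = m})"
  proof (rule sum.cong)
    fix e assume e: "e \<in> J"
    have "expect (\<lambda>\<omega>. of_bool (\<omega> e) * of_bool (count (J - {e}) \<omega> = m)) =
       expect (\<lambda>\<omega>. of_bool (\<omega> e)) * expect (\<lambda>\<omega>. of_bool (count (J - {e}) \<omega> = m))"
      using e assms
      by (intro expect_mult [of "{e}"] depends_on_mono [OF depends_on_count]) (auto simp: depends_on_def)
    also have "expect (\<lambda>\<omega>. of_bool (\<omega> e)) = p e"
      using e assms expect_component [of e of_bool] by auto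
    finally show "expect (\<lambda>\<omega>. of_bool (\<omega> e) * of_bool (count (J - {e}) \<omega> = m)) =
       p e * prob {\<omega>. count (J - {e}) \<omega> = m}"
      by (simp add: prob_eq_expect)
  qed simp
  finally show ?thesis .
qed

text \<open>A Poisson point probability up to constants. Each use of the recursion
  \<open>prob_count_eq_Suc\<close> deletes one element and lowers the mean by at most
  \<open>q\<close>, so a mean of at least \<open>mean J - real m * q\<close> survives all
  \<open>m\<close> deletions. The factor 2 in the exponent comes from the empty count.\<close>

lemma prob_count_eq_ge:
  assumes "J \<subseteq> I" "\<And>e. e \<in> J \<Longrightarrow> p e \<le> q" "0 \<le> q" "q \<le> 1 / 2" "real m * q \<le> mean J"
  shows "exp (- 2 * mean J) * (mean J - real m * q) ^ m / fact m \<le> prob {\<omega>. count J \<omega> = m}"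
  using assms
proof (induction m arbitrary: J)
  case 0
  have "p e \<le> 1 / 2" if "e \<in> J" for e
    using 0(2) [OF that] 0(4) by linarith
  then show ?case
    using prob_count_eq_0_ge [OF 0(1)] by simp
next
  case (Suc m)
  let ?c = "exp (- 2 * mean J) * (mean J - real (Suc m) * q) ^ m / fact m"
  have J: "finite J"
    using Suc.prems finite_I finite_subset by auto
  have "?c * mean J = (\<Sum>e\<in>J. p e * ?c)"
    unfolding mean_def sum_distrib_right [symmetric] by (rule mult.commute)
  also have "\<dots> \<le> (\<Sum>e\<in>J. p e * prob {\<omega>. count (J - {e}) \<omega> = m})"
  proof (intro sum_mono mult_left_mono)
    fix e assume e: "e \<in> J"
    have pe: "0 \<le> p e" "p e \<le> q"
      using e Suc.prems p_nonneg by auto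
    have m: "mean (J - {e}) = mean J - p e"
      using J e by (simp add: mean_def sum_diff1)
    have "?c \<le> exp (- 2 * mean (J - {e})) * (mean (J - {e}) - real m * q) ^ m / fact m"
      using pe Suc.prems(5)
      by (intro divide_right_mono mult_mono power_mono) (auto simp: m algebra_simps)
    also have "\<dots> \<le> prob {\<omega>. count (J - {e}) \<omega> = m}"
      using Suc.prems pe by (intro Suc.IH) (auto simp: m algebra_simps)
    finally show "?c \<le> prob {\<omega>. count (J - {e}) \<omega> = m}" .
    show "0 \<le> p e" by (rule pe)
  qed
  also have "\<dots> = real (Suc m) * prob {\<omega>. count J \<omega> = Suc m}"
    using prob_count_eq_Suc Suc.prems by simp
  finally have *: "?c * mean J \<le> real (Suc m) * prob {\<omega>. count J \<omega> = Suc m}" .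
  have "exp (- 2 * mean J) * (mean J - real (Suc m) * q) ^ Suc m / fact (Suc m) =
      ?c * (mean J - real (Suc m) * q) / real (Suc m)"
    by (simp add: mult_ac)
  also have "\<dots> \<le> ?c * mean J / real (Suc m)"
    using Suc.prems(3,5) by (intro divide_right_mono mult_left_mono) auto
  also have "\<dots> \<le> prob {\<omega>. count J \<omega> = Suc m}"
    using * by (simp add: divide_simps mult.commute)
  finally show ?case .
qed

text \<open>Exponential Markov inequality for the lower tail: with \<open>N\<close> the number of
  large counts, the probability is at most \<open>2 powr x\<close> times the expectation of
  \<open>2 powr - N\<close>. Disjointness of the \<open>K i\<close> makes this a product, each
  factor being at most \<open>1 - q / 2\<close>.\<close>

lemma prob_few_large_counts_le:
  assumes "finite S" "\<And>i. i \<in> S \<Longrightarrow> K i \<subseteq> I" "disjoint_family_on K S"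
    and q: "\<And>i. i \<in> S \<Longrightarrow> q \<le> prob {\<omega>. m \<le> count (K i) \<omega>}" and x: "0 \<le> x"
  shows "prob {\<omega>. real (card {i \<in> S. m \<le> count (K i) \<omega>}) \<le> x} \<le> exp (x - real (card S) * q / 2)"
proof -
  have "prob {\<omega>. real (card {i \<in> S. m \<le> count (K i) \<omega>}) \<le> x} \<le>
     expect (\<lambda>\<omega>. 2 powr x * (\<Prod>i\<in>S. if m \<le> count (K i) \<omega> then 1 / 2 else 1))"
    unfolding prob_eq_expect
  proof (rule expect_mono)
    fix \<omega> :: "'e \<Rightarrow> bool"
    have eq: "(\<Prod>i\<in>S. if m \<le> count (K i) \<omega> then 1 / 2 else (1::real)) =
        2 powr - real (card {i \<in> S. m \<le> count (K i) \<omega>})"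
      using assms(1) by (simp add: prod.If_cases Int_def powr_minus powr_realpow power_one_over field_simps)
    have "1 \<le> 2 powr (x - real (card {i \<in> S. m \<le> count (K i) \<omega>}))"
      if "real (card {i \<in> S. m \<le> count (K i) \<omega>}) \<le> x"
      using that by (simp add: ge_one_powr_ge_zero)
    then show "of_bool (real (card {i \<in> S. m \<le> count (K i) \<omega>}) \<le> x) \<le>
       2 powr x * (\<Prod>i\<in>S. if m \<le> count (K i) \<omega> then 1 / 2 else (1::real))"
      unfolding eq by (auto simp: powr_add [symmetric])
  qed
  also have "\<dots> = 2 powr x * expect (\<lambda>\<omega>. \<Prod>i\<in>S. if m \<le> count (K i) \<omega> then 1 / 2 else 1)"
    by simp
  also have "expect (\<lambda>\<omega>. \<Prod>i\<in>S. if m \<le> count (K i) \<omega> then 1 / 2 else 1) =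
     (\<Prod>i\<in>S. expect (\<lambda>\<omega>. if m \<le> count (K i) \<omega> then 1 / 2 else 1))"
    using assms(1-3) depends_on_count [of "\<lambda>k. if m \<le> k then 1 / 2 else 1"]
    by (intro expect_prod [where K = K]) auto
  also have "\<dots> \<le> (\<Prod>i\<in>S. exp (- q / 2))"
  proof (intro prod_mono conjI)
    fix i assume i: "i \<in> S"
    have "expect (\<lambda>\<omega>. if m \<le> count (K i) \<omega> then 1 / 2 else 1) =
        expect (\<lambda>\<omega>. 1 - of_bool (m \<le> count (K i) \<omega>) / 2)"
      by (intro arg_cong [where f = expect]) auto
    also have "\<dots> = 1 - prob {\<omega>. m \<le> count (K i) \<omega>} / 2"
      by (simp add: prob_eq_expect)
    also have "\<dots> \<le> 1 + (- q / 2)"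
      using q [OF i] by simp
    also have "\<dots> \<le> exp (- q / 2)"
      by (rule exp_ge_add_one_self)
    finally show "expect (\<lambda>\<omega>. if m \<le> count (K i) \<omega> then 1 / 2 else 1) \<le> exp (- q / 2)" .
    show "0 \<le> expect (\<lambda>\<omega>. if m \<le> count (K i) \<omega> then 1 / 2 else 1)"
      by (rule Bochner_Integration.integral_nonneg) auto
  qed
  also have "\<dots> = exp (- real (card S) * q / 2)"
    by (simp add: exp_of_nat_mult [symmetric])
  also have "2 powr x \<le> exp x"
    using x ln_2_less_1 mult_left_mono [of "ln 2" 1 x] by (simp add: powr_def)
  finally show ?thesis
    by (simp add: exp_add [symmetric] algebra_simps)
qed

end

section \<open>Degrees of inhomogeneous random graphs\<close>

lemma sorted_eq_filter_append:
  fixes xs :: "'a :: linorder list"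
  assumes "sorted xs"
  shows "xs = filter (\<lambda>x. \<not> m \<le> x) xs @ filter (\<lambda>x. m \<le> x) xs"
  using assms
proof (induction xs)
  case (Cons x xs)
  show ?case
  proof (cases "m \<le> x")
    case True
    with Cons.prems have "\<forall>y\<in>set (x # xs). m \<le> y"
      by auto
    then have "filter (\<lambda>x. \<not> m \<le> x) (x # xs) = []" "filter (\<lambda>x. m \<le> x) (x # xs) = x # xs"
      unfolding filter_empty_conv filter_id_conv by auto
    then show ?thesis by simp
  next
    case False
    with Cons show ?thesis by simp
  qed
qed simp

lemma le_nth_rev_sort_iff:
  fixes xs :: "'a :: linorder list"
  assumes "j < length xs"
  shows "m \<le> rev (sort xs) ! j \<longleftrightarrow> j < length (filter (\<lambda>x. m \<le> x) xs)"
proof -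
  define us where "us = rev (filter (\<lambda>x. m \<le> x) (sort xs))"
  define vs where "vs = rev (filter (\<lambda>x. \<not> m \<le> x) (sort xs))"
  have eq: "rev (sort xs) = us @ vs"
    unfolding us_def vs_def rev_append [symmetric]
    by (subst sorted_eq_filter_append [of "sort xs" m]) auto
  have us: "m \<le> x" if "x \<in> set us" for x
    using that by (simp add: us_def)
  have vs: "\<not> m \<le> x" if "x \<in> set vs" for x
    using that by (simp add: vs_def)
  have len: "length us = length (filter (\<lambda>x. m \<le> x) xs)"
    by (simp add: us_def filter_sort)
  have "length us + length vs = length xs"
    using arg_cong [OF eq, of length] by simp
  then have "m \<le> (us @ vs) ! j \<longleftrightarrow> j < length us"
    using us [OF nth_mem, of j] vs [OF nth_mem, of "j - length us"] assms
    by (auto simp: nth_append)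
  then show ?thesis
    by (simp add: eq len)
qed

text \<open>Reduces all questions about ordered degrees to counting vertices above a level. The list
  index \<open>k - 1\<close> starts at 0, which turns the strict inequality of
  \<open>le_nth_rev_sort_iff\<close> into \<open>k \<le> card\<close>.\<close>

lemma le_ordered_degree_iff:
  assumes "1 \<le> k" "k \<le> n"
  shows "m \<le> ordered_degree n G k \<longleftrightarrow> k \<le> card {i \<in> {1..n}. m \<le> degree n G i}"
proof -
  have "length (filter (\<lambda>x. m \<le> x) (map (degree n G) [1..<n + 1])) =
      card ({i. m \<le> degree n G i} \<inter> set [1..<n + 1])"
    by (subst distinct_length_filter [symmetric]) (auto simp: filter_map o_def simp del: upt_Suc)
  also have "{i. m \<le> degree n G i} \<inter> set [1..<n + 1] = {i \<in> {1..n}. m \<le> degree n G i}"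
    by auto
  finally show ?thesis
    unfolding ordered_degree_def using assms by (subst le_nth_rev_sort_iff) (auto simp del: upt_Suc)
qed

text \<open>In a cut of maximal weight, moving one vertex to the other side gains nothing, so every
  vertex has at least as much weight across the cut as within its own side. \<open>S\<close> is the
  larger side.\<close>

lemma exists_heavy_cut:
  fixes w :: "'v \<Rightarrow> 'v \<Rightarrow> real"
  assumes V: "finite V" and sym: "\<And>i j. i \<in> V \<Longrightarrow> j \<in> V \<Longrightarrow> w i j = w j i"
  obtains S where "S \<subseteq> V" "card V \<le> 2 * card S"
    and "\<And>i. i \<in> S \<Longrightarrow> (\<Sum>j\<in>V - {i}. w i j) \<le> 2 * (\<Sum>j\<in>V - S. w i j)"
proof -
  define c where "c A = (\<Sum>i\<in>A. \<Sum>j\<in>V - A. w i j)" for A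
  have "Max (c ` Pow V) \<in> c ` Pow V"
    using V by (intro Max_in) auto
  then obtain A where A: "A \<subseteq> V" "c A = Max (c ` Pow V)"
    by auto
  have max: "c B \<le> c A" if "B \<subseteq> V" for B
    using that V A by (auto intro!: Max_ge)
  have compl: "c (V - B) = c B" if "B \<subseteq> V" for B
  proof -
    have "c (V - B) = (\<Sum>i\<in>V - B. \<Sum>j\<in>B. w i j)"
      using that by (simp add: c_def double_diff)
    also have "\<dots> = (\<Sum>j\<in>B. \<Sum>i\<in>V - B. w i j)"
      by (rule sum.swap)
    also have "\<dots> = c B"
      unfolding c_def using that sym by (intro sum.cong) auto
    finally show ?thesis .
  qed
  \<comment> \<open>Stated for every maximal \<open>B\<close>, because by \<open>compl\<close> both
    sides of the cut qualify and either may be the larger one.\<close>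
  have loc: "(\<Sum>j\<in>V - {i}. w i j) \<le> 2 * (\<Sum>j\<in>V - B. w i j)"
    if B: "B \<subseteq> V" "c B = c A" and i: "i \<in> B" for B i
  proof -
    define C where "C = B - {i}"
    have C: "B = insert i C" "i \<notin> C" "V - C = insert i (V - B)" "i \<notin> V - B"
      using B i by (auto simp: C_def)
    have fin: "finite B" "finite C" "finite (V - B)"
      using B V finite_subset by (auto simp: C_def)
    have "c B = (\<Sum>j\<in>V - B. w i j) + (\<Sum>k\<in>C. \<Sum>j\<in>V - B. w k j)"
      using fin C(2) by (simp add: c_def C(1))
    moreover have "c C = (\<Sum>k\<in>C. w k i) + (\<Sum>k\<in>C. \<Sum>j\<in>V - B. w k j)"
      using fin C(4) by (simp add: c_def C(3) sum.distrib)
    moreover have "c C \<le> c B"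
      using max [of C] B by (auto simp: C_def)
    moreover have "(\<Sum>k\<in>C. w k i) = (\<Sum>k\<in>C. w i k)"
      using B i sym by (intro sum.cong) (auto simp: C_def)
    moreover have "(\<Sum>j\<in>V - {i}. w i j) = (\<Sum>k\<in>C. w i k) + (\<Sum>j\<in>V - B. w i j)"
    proof -
      have "V - {i} = C \<union> (V - B)" "C \<inter> (V - B) = {}"
        using B i by (auto simp: C_def)
      then show ?thesis
        using fin by (simp add: sum.union_disjoint)
    qed
    ultimately show ?thesis by linarith
  qed
  have card: "card A + card (V - A) = card V"
    using A V by (metis card_Un_disjoint Diff_disjoint Diff_partition finite_subset finite_Diff)
  show thesis
  proof (cases "card V \<le> 2 * card A")
    case True
    then show ?thesis
      using that [of A] A loc [of A] by simp
  next
    case False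
    then show ?thesis
      using that [of "V - A"] card loc [of "V - A"] compl [of A] A by simp
  qed
qed

section \<open>Degrees as counts over rows of edges\<close>

definition edge :: "nat \<Rightarrow> nat \<Rightarrow> nat \<times> nat" where
  "edge i j = (min i j, max i j)"

lemma edge_eq_iff: "edge i j = edge k l \<longleftrightarrow> i = k \<and> j = l \<or> i = l \<and> j = k"
  by (auto simp: edge_def min_def max_def split: if_splits)

lemma inj_on_edge: "inj_on (edge i) J"
  by (auto simp: inj_on_def edge_eq_iff)

lemma edge_in_possible_edges: "i \<in> {1..n} \<Longrightarrow> j \<in> {1..n} \<Longrightarrow> edge i j \<in> possible_edges n"
  by (auto simp: edge_def possible_edges_def)

lemma p_le_p_max:
  assumes "i \<in> {1..n}" "j \<in> {1..n}" "i \<noteq> j"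
  shows "p i j \<le> p_max n p"
proof -
  have "{p i j | i j. i \<in> {1..n} \<and> j \<in> {1..n} \<and> i \<noteq> j} \<subseteq> (\<lambda>(i, j). p i j) ` ({1..n} \<times> {1..n})"
    by auto
  then have "finite {p i j | i j. i \<in> {1..n} \<and> j \<in> {1..n} \<and> i \<noteq> j}"
    by (rule finite_subset) auto
  then show ?thesis
    unfolding p_max_def using assms by (intro Max_ge) auto
qed

locale inhomogeneous_graph =
  fixes n :: nat and p :: "nat \<Rightarrow> nat \<Rightarrow> real"
  assumes edge_probabilities: "edge_probabilities n p"
begin

lemma p_sym: "i \<in> {1..n} \<Longrightarrow> j \<in> {1..n} \<Longrightarrow> p i j = p j i"
  and p_bounds: "i \<in> {1..n} \<Longrightarrow> j \<in> {1..n} \<Longrightarrow> 0 \<le> p i j \<and> p i j \<le> 1"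
  using edge_probabilities unfolding edge_probabilities_def by blast+

sublocale bernoulli_family "possible_edges n" "\<lambda>(i, j). p i j"
proof
  have "possible_edges n \<subseteq> {1..n} \<times> {1..n}"
    by (auto simp: possible_edges_def)
  then show "finite (possible_edges n)"
    by (rule finite_subset) auto
qed (use p_bounds in \<open>auto simp: possible_edges_def\<close>)

lemma law_eq: "law = random_graph n p"
  unfolding law_def random_graph_def by (simp add: case_prod_beta')

lemma row_subset: "i \<in> {1..n} \<Longrightarrow> J \<subseteq> {1..n} \<Longrightarrow> edge i ` J \<subseteq> possible_edges n"
  using edge_in_possible_edges by blast

lemma p_edge: "i \<in> {1..n} \<Longrightarrow> j \<in> {1..n} \<Longrightarrow> (case edge i j of (i, j) \<Rightarrow> p i j) = p i j"
  using p_sym [of i j] by (auto simp: edge_def min_def max_def)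

lemma mean_row:
  assumes "i \<in> {1..n}" "J \<subseteq> {1..n}"
  shows "mean (edge i ` J) = (\<Sum>j\<in>J. p i j)"
  unfolding mean_def using assms
  by (subst sum.reindex [OF inj_on_edge]) (auto intro!: sum.cong p_edge)

lemma count_row:
  assumes "finite J"
  shows "count (edge i ` J) G = (\<Sum>j\<in>J. adjacency G i j)"
proof -
  have "{e \<in> edge i ` J. G e} = edge i ` {j \<in> J. G (edge i j)}"
    by auto
  then have "count (edge i ` J) G = card {j \<in> J. G (edge i j)}"
    by (simp add: count_def card_image inj_on_edge)
  also have "\<dots> = (\<Sum>j\<in>J. adjacency G i j)"
    using assms by (simp add: adjacency_def edge_def of_bool_def sum.If_cases Int_def)
  finally show ?thesis .
qed

lemma degree_eq_count: "degree n G i = count (edge i ` {1..n}) G"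
  by (simp add: degree_def count_row)

text \<open>First moment method: Markov's inequality for the number of vertices of large degree.
  Linearity of expectation copes with the dependence between degrees, and each vertex contributes a
  Chernoff bound.\<close>

lemma prob_many_large_degrees_le:
  assumes d: "\<And>i. i \<in> {1..n} \<Longrightarrow> mean_degree n p i \<le> d" and z: "1 \<le> z" and y: "0 < y"
  shows "prob {G. y \<le> real (card {i \<in> {1..n}. a \<le> real (degree n G i)})} \<le>
    real n * (exp (d * (z - 1)) * z powr - a) / y"
proof -
  have "y * prob {G. y \<le> real (card {i \<in> {1..n}. a \<le> real (degree n G i)})} \<le>
      expect (\<lambda>G. real (card {i \<in> {1..n}. a \<le> real (degree n G i)}))"
    unfolding prob_eq_expect integral_mult_right_zero [symmetric] using y by (intro expect_mono) auto
  also have "\<dots> = expect (\<lambda>G. \<Sum>i\<in>{1..n}. of_bool (a \<le> real (degree n G i)))"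
    by (intro arg_cong [where f = expect]) (simp add: of_bool_def sum.If_cases Int_def fun_eq_iff)
  also have "\<dots> = (\<Sum>i\<in>{1..n}. expect (\<lambda>G. of_bool (a \<le> real (degree n G i))))"
    by (rule Bochner_Integration.integral_sum) simp
  also have "\<dots> = (\<Sum>i\<in>{1..n}. prob {G. a \<le> real (count (edge i ` {1..n}) G)})"
    by (simp add: prob_eq_expect degree_eq_count)
  also have "\<dots> \<le> (\<Sum>i\<in>{1..n}. exp (d * (z - 1)) * z powr - a)"
  proof (rule sum_mono)
    fix i assume i: "i \<in> {1..n}"
    have "prob {G. a \<le> real (count (edge i ` {1..n}) G)} \<le>
        exp (mean (edge i ` {1..n}) * (z - 1)) * z powr - a"
      using i z by (intro prob_count_ge_le row_subset) auto
    also have "mean (edge i ` {1..n}) = mean_degree n p i"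
      using i by (simp add: mean_row mean_degree_def)
    also have "exp (mean_degree n p i * (z - 1)) * z powr - a \<le> exp (d * (z - 1)) * z powr - a"
      using d [OF i] z by (intro mult_right_mono) (auto intro: mult_right_mono)
    finally show "prob {G. a \<le> real (count (edge i ` {1..n}) G)} \<le> exp (d * (z - 1)) * z powr - a" .
  qed
  also have "\<dots> = real n * (exp (d * (z - 1)) * z powr - a)"
    by simp
  finally show ?thesis
    by (subst pos_le_divide_eq [OF y]) (simp only: mult.commute)
qed

text \<open>Degrees are dependent because two vertices share an edge. Counting for \<open>i\<close>
  in \<open>S\<close> only the neighbours outside \<open>S\<close> removes this: such an edge has
  just one end in \<open>S\<close>. By the choice of the cut these counts keep mean at least
  \<open>c\<close>, and \<open>card S\<close> is at least \<open>n / 2\<close>, which turns the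
  denominator 2 of \<open>prob_few_large_counts_le\<close> into 4.\<close>

lemma prob_few_large_degrees_le:
  assumes d: "\<And>i. i \<in> {1..n} \<Longrightarrow> mean_degree n p i \<le> d"
    and c: "\<And>i. i \<in> {1..n} \<Longrightarrow> 2 * c \<le> loopless_mean_degree n p i" and "0 \<le> c"
    and q: "p_max n p \<le> q" "0 \<le> q" "q \<le> 1 / 2" "real m * q \<le> c / 2" and x: "0 \<le> x"
  shows "prob {G. real (card {i \<in> {1..n}. m \<le> degree n G i}) \<le> x} \<le>
    exp (x - real n * (exp (- 2 * d) * (c / 2) ^ m / fact m) / 4)"
proof -
  let ?V = "{1..n}"
  let ?r = "exp (- 2 * d) * (c / 2) ^ m / fact m"
  obtain S where S: "S \<subseteq> ?V" "card ?V \<le> 2 * card S"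
    and half: "\<And>i. i \<in> S \<Longrightarrow> (\<Sum>j\<in>?V - {i}. p i j) \<le> 2 * (\<Sum>j\<in>?V - S. p i j)"
    using p_sym by (rule exists_heavy_cut [of ?V p, rotated]) auto
  have fin: "finite S"
    using S finite_subset by blast
  define K where "K i = edge i ` (?V - S)" for i
  have K: "K i \<subseteq> possible_edges n" if "i \<in> S" for i
    unfolding K_def using that S by (intro row_subset) auto
  have disj: "disjoint_family_on K S"
    using S by (auto simp: disjoint_family_on_def K_def edge_eq_iff)
  have r: "?r \<le> prob {G. m \<le> count (K i) G}" if i: "i \<in> S" for i
  proof -
    have iV: "i \<in> ?V"
      using i S by blast
    have mean: "mean (K i) = (\<Sum>j\<in>?V - S. p i j)"
      unfolding K_def using iV by (intro mean_row) auto
    have c_le: "c \<le> mean (K i)"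
      using half [OF i] c [OF iV] unfolding mean loopless_mean_degree_def by simp
    have "mean (K i) \<le> mean_degree n p i"
      unfolding mean mean_degree_def using p_bounds [OF iV] by (intro sum_mono2) auto
    also have "\<dots> \<le> d"
      by (rule d [OF iV])
    finally have mean_le: "mean (K i) \<le> d" .
    \<comment> \<open>The mean lies between \<open>c\<close> and \<open>d\<close>, and the loss
      \<open>real m * q\<close> is at most \<open>c / 2\<close>.\<close>
    have "?r \<le> exp (- 2 * mean (K i)) * (mean (K i) - real m * q) ^ m / fact m"
      using mean_le c_le q(4) \<open>0 \<le> c\<close>
      by (intro divide_right_mono mult_mono power_mono) auto
    also have "\<dots> \<le> prob {G. count (K i) G = m}"
    proof (rule prob_count_eq_ge)
      fix e assume "e \<in> K i"
      \<comment> \<open>Here \<open>j\<close> lies outside \<open>S\<close>, so \<open>K i\<close>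
        contains no loop and \<open>p_max\<close> bounds all of its probabilities.\<close>
      then obtain j where j: "j \<in> ?V" "j \<noteq> i" "e = edge i j"
        using i unfolding K_def by blast
      then show "(case e of (i, j) \<Rightarrow> p i j) \<le> q"
        using p_le_p_max [of i n j p] p_edge [of i j] iV q(1) by simp
    qed (use K i q c_le \<open>0 \<le> c\<close> in auto)
    also have "\<dots> \<le> prob {G. m \<le> count (K i) G}"
      by (intro measure_pmf.finite_measure_mono) auto
    finally show ?thesis .
  qed
  have "prob {G. real (card {i \<in> ?V. m \<le> degree n G i}) \<le> x} \<le>
      prob {G. real (card {i \<in> S. m \<le> count (K i) G}) \<le> x}"
  proof (rule measure_pmf.finite_measure_mono)
    have "count (K i) G \<le> degree n G i" for i G
      unfolding K_def degree_def by (subst count_row) (auto intro: sum_mono2)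
    then have "card {i \<in> S. m \<le> count (K i) G} \<le> card {i \<in> ?V. m \<le> degree n G i}" for G
      using S by (intro card_mono) (auto intro: order_trans)
    then show "{G. real (card {i \<in> ?V. m \<le> degree n G i}) \<le> x} \<subseteq>
        {G. real (card {i \<in> S. m \<le> count (K i) G}) \<le> x}"
      by (smt (verit) Collect_mono of_nat_mono)
  qed simp
  also have "\<dots> \<le> exp (x - real (card S) * ?r / 2)"
    using fin K disj r x by (rule prob_few_large_counts_le)
  also have "\<dots> \<le> exp (x - real n * ?r / 4)"
  proof -
    have "real n / 2 * ?r \<le> real (card S) * ?r"
      using S \<open>0 \<le> c\<close> by (intro mult_right_mono) auto
    moreover have "exp (x - b * u / 2) \<le> exp (x - a * u / 4)" if "a / 2 * u \<le> b * u" for a b u :: real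
      using that by simp
    ultimately show ?thesis by blast
  qed
  finally show ?thesis .
qed

end

section \<open>The number of vertices above a given level\<close>

lemma fact_le_power_real:
  assumes "real m \<le> x"
  shows "fact m \<le> x ^ m"
proof -
  have "fact m \<le> real (m ^ m)"
    using fact_le_power [of m] by simp
  also have "\<dots> \<le> x ^ m"
    using assms by (simp add: power_mono)
  finally show ?thesis .
qed

section \<open>Comparison of the number of vertices above a level with
  \<open>n powr (1 - lam)\<close>\<close>

context inhomogeneous_graph
begin

text \<open>With the tilt \<open>z = T powr (1 - \<delta> / 4)\<close>, the factor
  \<open>z powr - a\<close> beats \<open>exp (- lam * l)\<close> by at least
  \<open>exp (- \<delta> / 2 * lam * l)\<close>, hence by
  \<open>exp (- l * \<epsilon> * \<delta> / 4)\<close>. Half of this gain pays for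
  \<open>exp (d * (z - 1))\<close>, since \<open>d * z = l * T powr (- \<delta> / 4)\<close> is
  small compared with \<open>l\<close>.\<close>

lemma prob_upper_level:
  fixes d \<epsilon> \<delta> lam :: real
  defines "l \<equiv> ln (real n)"
  defines "T \<equiv> l / d"
  assumes n: "0 < n" and d: "\<And>i. i \<in> {1..n} \<Longrightarrow> mean_degree n p i \<le> d" "0 < d"
    and eps: "0 < \<epsilon>" and \<delta>: "0 < \<delta>" "\<delta> < 1" and lam: "\<epsilon> / 2 \<le> lam"
    and T: "1 < T" "T powr (- \<delta> / 4) \<le> \<epsilon> * \<delta> / 8"
  shows "prob {G. real n powr (1 - lam) \<le>
      real (card {i \<in> {1..n}. (1 + \<delta>) * (lam * l / ln T) \<le> real (degree n G i)})} \<le>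
    exp (- (l * \<epsilon> * \<delta> / 8))"
proof -
  define a where "a = (1 + \<delta>) * (lam * l / ln T)"
  define z where "z = T powr (1 - \<delta> / 4)"
  have l: "0 < l"
    using T(1) d(2) by (auto simp: T_def field_simps)
  have lnT: "0 < ln T"
    using T(1) by simp
  have z: "1 \<le> z"
    unfolding z_def using T(1) \<delta> by (intro ge_one_powr_ge_zero) auto
  have "d * (z - 1) \<le> d * z"
    using d by simp
  also have "d * z = l * T powr (- \<delta> / 4)"
  proof -
    have "z = T * T powr (- \<delta> / 4)"
      using T(1) powr_add [of T 1 "- \<delta> / 4"] by (simp add: z_def)
    moreover have "d * T = l"
      using d by (simp add: T_def)
    ultimately show ?thesis
      by (metis mult.assoc)
  qed
  also have "\<dots> \<le> l * (\<epsilon> * \<delta> / 8)"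
    using l T(2) by (intro mult_left_mono) auto
  finally have z1: "d * (z - 1) \<le> l * \<epsilon> * \<delta> / 8" by simp
  have z2: "z powr - a = exp (- ((1 + \<delta>) * (1 - \<delta> / 4) * (lam * l)))"
    using T(1) lnT by (simp add: z_def powr_powr powr_def a_def)
  have "prob {G. real n powr (1 - lam) \<le> real (card {i \<in> {1..n}. a \<le> real (degree n G i)})} \<le>
    real n * (exp (d * (z - 1)) * z powr - a) / real n powr (1 - lam)"
    using d z n by (intro prob_many_large_degrees_le) auto
  also have "\<dots> = exp (lam * l + d * (z - 1) - (1 + \<delta>) * (1 - \<delta> / 4) * (lam * l))"
  proof -
    have "exp l * (exp A * exp (- B)) / exp ((1 - lam) * l) = exp (lam * l + A - B)" for A B
      by (simp add: exp_add [symmetric] exp_diff [symmetric] algebra_simps)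
    moreover have "real n = exp l" "real n powr (1 - lam) = exp ((1 - lam) * l)"
      using n by (simp_all add: l_def powr_def)
    ultimately show ?thesis
      unfolding z2 by simp
  qed
  also have "\<dots> \<le> exp (- (l * \<epsilon> * \<delta> / 8))"
  proof -
    have "1 + \<delta> / 2 \<le> (1 + \<delta>) * (1 - \<delta> / 4)"
      using \<delta> by (simp add: field_simps)
    then have "(1 + \<delta> / 2) * (lam * l) \<le> (1 + \<delta>) * (1 - \<delta> / 4) * (lam * l)"
      using l lam eps by (intro mult_right_mono) auto
    moreover have "\<epsilon> / 2 * (\<delta> / 2 * l) \<le> lam * (\<delta> / 2 * l)"
      using \<delta> l lam by (intro mult_right_mono) auto
    ultimately show ?thesis
      using z1 by (simp add: algebra_simps)
  qed
  finally show ?thesis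
    unfolding a_def .
qed

text \<open>The Poisson-type bound \<open>r\<close> for one vertex is about
  \<open>T powr - m\<close>, as \<open>m\<close> is at most \<open>l\<close> and so
  \<open>fact m \<le> l ^ m\<close>. Since \<open>m\<close> is below \<open>lam * l / ln T\<close>
  by a factor \<open>1 - \<delta> / 2\<close>, the product \<open>n * r\<close> exceeds
  \<open>n powr (1 - lam)\<close> by a factor \<open>exp s\<close>, even after the losses from the
  constant \<open>c\<close> and from \<open>exp (- 2 * d)\<close>.\<close>

lemma prob_lower_level:
  fixes d \<epsilon> \<delta> lam c q :: real
  defines "l \<equiv> ln (real n)"
  defines "T \<equiv> l / d"
  assumes n: "0 < n" and d: "\<And>i. i \<in> {1..n} \<Longrightarrow> mean_degree n p i \<le> d" "0 < d"
    and c: "\<And>i. i \<in> {1..n} \<Longrightarrow> 2 * (c * d) \<le> loopless_mean_degree n p i" "0 < c"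
    and q: "p_max n p \<le> q" "0 \<le> q" "q \<le> 1 / 2" "l * q \<le> c * d / 2"
    and eps: "0 < \<epsilon>" and \<delta>: "0 < \<delta>" "\<delta> < 1" and lam: "\<epsilon> / 2 \<le> lam" "lam \<le> 1"
    and T: "1 < T" "1 \<le> ln T" "ln (2 / c) \<le> \<delta> / 4 * ln T" "2 / T \<le> \<delta> * \<epsilon> / 16"
    and l: "ln T \<le> \<delta> * \<epsilon> * l / 4" "8 \<le> exp (l * \<epsilon> * \<delta> / 16)"
  shows "prob {G. real (card {i \<in> {1..n}. (1 - \<delta>) * (lam * l / ln T) \<le> real (degree n G i)}) \<le>
      real n powr (1 - lam)} \<le> exp (- (exp (l * \<epsilon> * \<delta> / 16) / 8))"
proof -
  define a where "a = (1 - \<delta>) * (lam * l / ln T)"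
  define m where "m = nat \<lceil>a\<rceil>"
  define x where "x = real n powr (1 - lam)"
  define s where "s = l * \<epsilon> * \<delta> / 16"
  define r where "r = exp (- 2 * d) * (c * d / 2) ^ m / fact m"
  have l_pos: "0 < l"
    using T(1) d(2) by (auto simp: T_def field_simps)
  have lam_pos: "0 < lam"
    using eps lam by linarith
  have m_eq: "m \<le> k \<longleftrightarrow> a \<le> real k" for k
    unfolding m_def by (rule nat_ceiling_le_eq)
  have "0 \<le> a"
    unfolding a_def using \<delta> l_pos lam_pos T by auto
  then have "real m \<le> a + 1"
    unfolding m_def by linarith
  \<comment> \<open>Rounding \<open>a\<close> up to \<open>m\<close> costs at most 1, which is
    absorbed by half of the slack \<open>\<delta>\<close>.\<close>
  also have "\<dots> \<le> (1 - \<delta> / 2) * (lam * l / ln T)"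
  proof -
    have "ln T \<le> \<delta> / 2 * (lam * l)"
    proof -
      have "\<epsilon> / 2 * (\<delta> / 2 * l) \<le> lam * (\<delta> / 2 * l)"
        using \<delta> l_pos lam by (intro mult_right_mono) auto
      then show ?thesis
        using l(1) by (simp add: algebra_simps)
    qed
    then have "1 \<le> \<delta> / 2 * (lam * l / ln T)"
      using T by (simp add: field_simps)
    moreover have "(1 - \<delta>) * u + \<delta> / 2 * u = (1 - \<delta> / 2) * u" for u
      by (simp add: algebra_simps)
    ultimately show ?thesis
      unfolding a_def by (metis add_left_mono)
  qed
  finally have m: "real m \<le> (1 - \<delta> / 2) * (lam * l / ln T)" .
  have m_le_l: "real m \<le> l"
  proof -
    have "lam * l / ln T \<le> l"
      using lam lam_pos l_pos T mult_mono [of lam 1 l "l * ln T"]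
      by (simp add: divide_le_eq mult_le_cancel_left1)
    moreover have "(1 - \<delta> / 2) * (lam * l / ln T) \<le> 1 * (lam * l / ln T)"
      using \<delta> lam_pos l_pos T by (intro mult_right_mono) auto
    ultimately show ?thesis
      using m by linarith
  qed
  have "exp (- 2 * d) * exp (- ((1 - \<delta> / 4) * (lam * l))) \<le> r"
  proof -
    \<comment> \<open>The constant \<open>2 / c\<close> is at most
      \<open>T powr (\<delta> / 4)\<close>, and \<open>(1 - \<delta> / 2) * (1 + \<delta> / 4) \<le>
      1 - \<delta> / 4\<close>.\<close>
    have "exp (- ((1 - \<delta> / 4) * (lam * l))) \<le> exp (- (real m * ln (2 * T / c)))"
    proof -
      have "ln (2 * T / c) = ln T + ln (2 / c)"
        using T c by (simp add: ln_mult ln_div)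
      also have "\<dots> \<le> (1 + \<delta> / 4) * ln T"
        using T by (simp add: algebra_simps)
      finally have "real m * ln (2 * T / c) \<le> real m * ((1 + \<delta> / 4) * ln T)"
        by (intro mult_left_mono) auto
      also have "\<dots> \<le> (1 - \<delta> / 2) * (lam * l / ln T) * ((1 + \<delta> / 4) * ln T)"
        using m \<delta> T by (intro mult_right_mono) auto
      also have "\<dots> = ((1 - \<delta> / 2) * (1 + \<delta> / 4)) * (lam * l)"
        using T by simp
      also have "\<dots> \<le> (1 - \<delta> / 4) * (lam * l)"
        using \<delta> lam_pos l_pos by (intro mult_right_mono) (auto simp: algebra_simps)
      finally show ?thesis by simp
    qed
    also have "\<dots> = (c * d / (2 * l)) ^ m"
    proof -
      have "exp (- (real m * ln y)) = inverse y ^ m" if "0 < y" for y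
        using that by (simp add: exp_minus exp_of_nat_mult power_inverse)
      then have "exp (- (real m * ln (2 * T / c))) = inverse (2 * T / c) ^ m"
        using T c by simp
      also have "inverse (2 * T / c) = c * d / (2 * l)"
        by (simp add: T_def)
      finally show ?thesis .
    qed
    also have "\<dots> = (c * d / 2) ^ m / l ^ m"
      by (simp add: power_divide power_mult_distrib)
    also have "\<dots> \<le> (c * d / 2) ^ m / fact m"
      using fact_le_power_real [OF m_le_l] c d by (intro divide_left_mono) (auto simp: l_pos)
    finally show ?thesis
      unfolding r_def times_divide_eq_right [symmetric] by (intro mult_left_mono) auto
  qed
  then have "real n * (exp (- 2 * d) * exp (- ((1 - \<delta> / 4) * (lam * l)))) \<le> real n * r"
    by (intro mult_left_mono) auto
  moreover have "x * exp s \<le> real n * (exp (- 2 * d) * exp (- ((1 - \<delta> / 4) * (lam * l))))"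
  proof -
    have "x * exp s = exp ((1 - lam) * l + s)"
      using n by (simp add: x_def powr_def l_def exp_add)
    \<comment> \<open>The surplus \<open>\<delta> / 4 * lam * l\<close> is at least
      \<open>\<delta> * \<epsilon> * l / 8\<close>; one half of that is \<open>s\<close> and the
      other half covers \<open>2 * d\<close>.\<close>
    also have "\<dots> \<le> exp (l + (- 2 * d + - ((1 - \<delta> / 4) * (lam * l))))"
    proof -
      have "\<epsilon> / 2 * (\<delta> / 4 * l) \<le> lam * (\<delta> / 4 * l)"
        using \<delta> l_pos lam by (intro mult_right_mono) auto
      moreover have "2 * d \<le> \<delta> * \<epsilon> / 16 * l"
        using T(4) l_pos d by (simp add: T_def field_simps)
      ultimately show ?thesis
        by (simp add: s_def algebra_simps)
    qed
    also have "\<dots> = real n * (exp (- 2 * d) * exp (- ((1 - \<delta> / 4) * (lam * l))))"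
      using n by (simp only: exp_add l_def) simp
    finally show ?thesis .
  qed
  ultimately have nr: "x * exp s \<le> real n * r" by linarith
  have x: "1 \<le> x"
    unfolding x_def using n lam by (intro ge_one_powr_ge_zero) auto
  have "prob {G. real (card {i \<in> {1..n}. m \<le> degree n G i}) \<le> x} \<le>
      exp (x - real n * (exp (- 2 * d) * (c * d / 2) ^ m / fact m) / 4)"
  proof (rule prob_few_large_degrees_le)
    show "real m * q \<le> c * d / 2"
      using mult_right_mono [OF m_le_l q(2)] q(4) by linarith
  qed (use d c q x in auto)
  also have "\<dots> \<le> exp (x - x * exp s / 4)"
    using nr unfolding r_def [symmetric] by simp
  \<comment> \<open>\<open>exp s \<ge> 8\<close> lets half of the negative term swallow
    \<open>x\<close>, and \<open>x \<ge> 1\<close> removes \<open>x\<close> from the rest.\<close>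
  also have "\<dots> \<le> exp (- (exp s / 8))"
  proof -
    have "x * 8 \<le> x * exp s" "1 * exp s \<le> x * exp s"
      using x l(2) by (auto simp: s_def)
    then have "x - x * exp s / 4 \<le> - (exp s / 8)"
      by linarith
    then show ?thesis by simp
  qed
  finally show ?thesis
    unfolding m_eq a_def x_def s_def .
qed

end

text \<open>Writing \<open>k = n powr \<theta>\<close>, the exponent lies between neighbouring grid
  points \<open>j / M\<close> and \<open>Suc j / M\<close>. Fewer than
  \<open>n powr (j / M) \<le> k\<close> vertices reach the upper level at \<open>j\<close>, and more
  than \<open>n powr (Suc j / M) \<ge> k\<close> reach the lower level at \<open>Suc j\<close>,
  which encloses the \<open>k\<close>-th degree. The mesh changes the levels by a further factor
  \<open>1 \<plusminus> \<delta>\<close> at most; squaring gives the constants 2 and 3.\<close>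

lemma ordered_degree_between:
  fixes n M k :: nat and \<epsilon> \<delta> t :: real
  defines "l \<equiv> ln (real n)"
  assumes eps: "0 < \<epsilon>" "\<epsilon> < 1" and \<delta>: "0 < \<delta>" "\<delta> < 1" and t: "0 < t" and M: "2 / (\<delta> * \<epsilon>) \<le> real M"
    and n: "1 < n" and k: "1 \<le> k" "real k \<le> real n powr (1 - \<epsilon>)"
    and upper: "\<And>j. j \<le> M \<Longrightarrow> real j / real M \<le> 1 - \<epsilon> / 2 \<Longrightarrow>
      real (card {i \<in> {1..n}. (1 + \<delta>) * ((1 - j / M) * l / t) \<le> real (degree n G i)}) < real n powr (j / M)"
    and lower: "\<And>j. j \<le> M \<Longrightarrow> real j / real M \<le> 1 - \<epsilon> / 2 \<Longrightarrow>
      real n powr (j / M) < real (card {i \<in> {1..n}. (1 - \<delta>) * ((1 - j / M) * l / t) \<le> real (degree n G i)})"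
  shows "(1 - 2 * \<delta>) * (ln (real n / real k) / t) \<le> real (ordered_degree n G k)"
    and "real (ordered_degree n G k) \<le> (1 + 3 * \<delta>) * (ln (real n / real k) / t)"
proof -
  define \<theta> where "\<theta> = ln (real k) / l"
  define D where "D = real (ordered_degree n G k)"
  have l: "0 < l"
    using n by (simp add: l_def)
  have "0 < 2 / (\<delta> * \<epsilon>)"
    using eps \<delta> by simp
  then have M0: "0 < real M"
    using M by linarith
  have k_eq: "real k = real n powr \<theta>"
    using n k l by (simp add: \<theta>_def powr_def l_def)
  then have \<theta>: "0 \<le> \<theta>" "\<theta> \<le> 1 - \<epsilon>"
  proof -
    show "0 \<le> \<theta>"
      using k l by (simp add: \<theta>_def)
    show "\<theta> \<le> 1 - \<epsilon>"
      using k(2) n unfolding k_eq by simp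
  qed
  have "real n powr \<theta> \<le> real n powr 1"
    using n \<theta> eps by (intro powr_mono) auto
  then have k_le: "k \<le> n"
    using n unfolding k_eq [symmetric] by simp
  have L: "ln (real n / real k) = (1 - \<theta>) * l"
    using n k l by (simp add: ln_div \<theta>_def l_def algebra_simps)
  have le_D: "a \<le> D \<longleftrightarrow> k \<le> card {i \<in> {1..n}. a \<le> real (degree n G i)}" for a
    unfolding D_def nat_ceiling_le_eq [symmetric] by (rule le_ordered_degree_iff [OF k(1) k_le])
  define j where "j = nat \<lfloor>\<theta> * M\<rfloor>"
  have j: "real j \<le> \<theta> * M" "\<theta> * M \<le> real j + 1"
    using \<theta> M0 by (auto simp: j_def)
  have jM: "real j / M \<le> \<theta>" "\<theta> \<le> real (Suc j) / M"
    using j M0 by (auto simp: field_simps)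
  then have "\<theta> - 1 / M \<le> real j / M" "real (Suc j) / M \<le> \<theta> + 1 / M"
    by (auto simp: add_divide_distrib)
  note jM = jM this
  \<comment> \<open>Since \<open>\<theta> \<le> 1 - \<epsilon>\<close>, this mesh is fine enough
    both to keep \<open>Suc j / M\<close> below \<open>1 - \<epsilon> / 2\<close> and to be small
    relative to \<open>1 - \<theta>\<close>.\<close>
  have M1: "1 / M \<le> \<delta> * \<epsilon> / 2"
    using M M0 eps \<delta> by (simp add: field_simps)
  moreover have "\<delta> * \<epsilon> \<le> \<epsilon>"
    using eps \<delta> by simp
  ultimately have jS: "real (Suc j) / M \<le> 1 - \<epsilon> / 2"
    using jM(4) \<theta> by linarith
  have "real (Suc j) / M \<le> 1"
    using jS eps by linarith
  then have Suc_j: "Suc j \<le> M"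
    using M0 by (simp add: field_simps)
  have M2: "1 / M \<le> \<delta> * (1 - \<theta>)"
  proof -
    have "\<delta> * \<epsilon> \<le> \<delta> * (1 - \<theta>)"
      using \<delta> \<theta> by (intro mult_left_mono) auto
    moreover have "0 \<le> \<delta> * \<epsilon>"
      using \<delta> eps by simp
    ultimately show ?thesis
      using M1 by linarith
  qed
  have lt: "0 < l / t"
    using l t by simp
  have "real j / M \<le> 1 - \<epsilon> / 2"
    using jM(1) \<theta> eps by linarith
  then have "real (card {i \<in> {1..n}. (1 + \<delta>) * ((1 - j / M) * l / t) \<le> real (degree n G i)}) <
      real n powr (j / M)"
    using Suc_j by (intro upper) auto
  also have "\<dots> \<le> real k"
    unfolding k_eq using n jM(1) by (intro powr_mono) auto
  finally have "\<not> (1 + \<delta>) * ((1 - j / M) * l / t) \<le> D"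
    unfolding le_D by simp
  then have "D \<le> (1 + \<delta>) * (1 - j / M) * (l / t)"
    by simp
  also have "\<dots> \<le> (1 + 3 * \<delta>) * (1 - \<theta>) * (l / t)"
  proof (rule mult_right_mono)
    have "(1 + \<delta>) * (1 - j / M) \<le> (1 + \<delta>) * ((1 + \<delta>) * (1 - \<theta>))"
      using jM(3) M2 \<delta> by (intro mult_left_mono) (auto simp: algebra_simps)
    also have "\<dots> = (1 + \<delta>) * (1 + \<delta>) * (1 - \<theta>)"
      by simp
    also have "\<dots> \<le> (1 + 3 * \<delta>) * (1 - \<theta>)"
      using \<theta> eps \<delta> by (intro mult_right_mono) (auto simp: algebra_simps)
    finally show "(1 + \<delta>) * (1 - j / M) \<le> (1 + 3 * \<delta>) * (1 - \<theta>)" .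
  qed (use lt in simp)
  finally show "real (ordered_degree n G k) \<le> (1 + 3 * \<delta>) * (ln (real n / real k) / t)"
    by (simp add: L D_def)
  have "(1 - 2 * \<delta>) * (1 - \<theta>) * (l / t) \<le> (1 - \<delta>) * (1 - Suc j / M) * (l / t)"
  proof (rule mult_right_mono)
    have "(1 - 2 * \<delta>) * (1 - \<theta>) \<le> (1 - \<delta>) * (1 - \<delta>) * (1 - \<theta>)"
      using \<theta> eps \<delta> by (intro mult_right_mono) (auto simp: algebra_simps)
    also have "\<dots> = (1 - \<delta>) * ((1 - \<delta>) * (1 - \<theta>))"
      by simp
    also have "\<dots> \<le> (1 - \<delta>) * (1 - Suc j / M)"
      using jM(4) M2 \<delta> by (intro mult_left_mono) (auto simp: algebra_simps)
    finally show "(1 - 2 * \<delta>) * (1 - \<theta>) \<le> (1 - \<delta>) * (1 - Suc j / M)" .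
  qed (use lt in simp)
  also have "\<dots> \<le> D"
  proof -
    have "real k \<le> real n powr (Suc j / M)"
      unfolding k_eq using n jM(2) by (intro powr_mono) auto
    also have "\<dots> < real (card {i \<in> {1..n}. (1 - \<delta>) * ((1 - Suc j / M) * l / t) \<le> real (degree n G i)})"
      using Suc_j jS by (rule lower)
    finally have "(1 - \<delta>) * ((1 - Suc j / M) * l / t) \<le> D"
      unfolding le_D by simp
    then show ?thesis by simp
  qed
  finally show "(1 - 2 * \<delta>) * (ln (real n / real k) / t) \<le> real (ordered_degree n G k)"
    by (simp add: L D_def)
qed

section \<open>Uniformity in the parameters\<close>

definition regular_regime :: "nat \<Rightarrow> real \<Rightarrow> real \<Rightarrow> (nat \<Rightarrow> nat \<Rightarrow> real) \<Rightarrow> bool" where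
  "regular_regime n \<kappa> \<eta> p \<longleftrightarrow>
     edge_probabilities n p \<and>
     (\<forall>i\<in>{1..n}. mean_degree n p i = max_mean_degree n p) \<and>
     \<kappa> \<le> max_mean_degree n p \<and>
     max_mean_degree n p \<le> \<eta> * ln (real n) \<and>
     p_max n p \<le> real n powr (- 1 + \<eta>) \<and>
     (\<forall>i\<in>{1..n}. \<kappa> / 2 \<le> loopless_mean_degree n p i)"

definition degrees_close :: "real \<Rightarrow> nat \<Rightarrow> (nat \<Rightarrow> nat \<Rightarrow> real) \<Rightarrow> real \<Rightarrow> graph set" where
  "degrees_close \<epsilon> n p \<delta> = close_event {1..nat \<lfloor>real n powr (1 - \<epsilon>)\<rfloor>}
     (\<lambda>k G. real (ordered_degree n G k)) (\<lambda>k G. L n p k) \<delta>"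

text \<open>\<open>close_event\<close> divides by the degree, whereas the estimates bound the degree
  by multiples of \<open>L\<close>. The choice \<open>\<delta> / 6\<close> leaves room for inverting
  the ratio.\<close>

lemma ratio_close:
  fixes D L \<delta> :: real
  assumes "0 < \<delta>" "\<delta> \<le> 1" "0 < L" "(1 - 2 * (\<delta> / 6)) * L \<le> D" "D \<le> (1 + 3 * (\<delta> / 6)) * L"
  shows "\<bar>L / D - 1\<bar> \<le> \<delta>"
proof -
  have D: "0 < D"
    using assms(4) mult_pos_pos [of "1 - 2 * (\<delta> / 6)" L] assms(1-3) by linarith
  have "L \<le> (1 + \<delta>) * ((1 - 2 * (\<delta> / 6)) * L)"
  proof -
    have "1 \<le> (1 + \<delta>) * (1 - 2 * (\<delta> / 6))"
      using assms(1,2) mult_left_mono [of \<delta> 1 \<delta>] by (simp add: algebra_simps)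
    then show ?thesis
      using mult_right_mono [of 1 "(1 + \<delta>) * (1 - 2 * (\<delta> / 6))" L] assms(3) by (simp add: mult.assoc)
  qed
  also have "\<dots> \<le> (1 + \<delta>) * D"
    using assms by (intro mult_left_mono) auto
  finally have 1: "L \<le> (1 + \<delta>) * D" .
  have "(1 - \<delta>) * D \<le> (1 - \<delta>) * ((1 + 3 * (\<delta> / 6)) * L)"
    using assms by (intro mult_left_mono) auto
  also have "\<dots> \<le> L"
  proof -
    have "(1 - \<delta>) * (1 + 3 * (\<delta> / 6)) \<le> 1"
      using assms(1,2) by (simp add: algebra_simps)
    then show ?thesis
      using mult_right_mono [of "(1 - \<delta>) * (1 + 3 * (\<delta> / 6))" 1 L] assms(3) by (simp add: mult.assoc)
  qed
  finally have 2: "(1 - \<delta>) * D \<le> L" .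
  have "L / D \<le> 1 + \<delta>" "1 - \<delta> \<le> L / D"
    using 1 2 D by (simp_all add: field_simps)
  then show ?thesis by linarith
qed

text \<open>Turns the fixed bound \<open>\<kappa> / 2\<close> into a fixed proportion of
  \<open>d\<close>, which may grow with \<open>n\<close>. For \<open>d \<le> 2\<close> the bound
  itself suffices; for larger \<open>d\<close> the loop contributes at most 1, less than half of
  \<open>d\<close>.\<close>

lemma loopless_mean_degree_ge:
  assumes p: "edge_probabilities n p" and i: "i \<in> {1..n}" and \<kappa>: "0 < \<kappa>"
    and d: "mean_degree n p i = d" "\<kappa> \<le> d" and loopless: "\<kappa> / 2 \<le> loopless_mean_degree n p i"
  shows "min (1 / 2) (\<kappa> / 4) * d \<le> loopless_mean_degree n p i"
proof (cases "d \<le> 2")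
  case True
  then have "\<kappa> / 4 * d \<le> \<kappa> / 4 * 2"
    using \<kappa> by (intro mult_left_mono) auto
  moreover have "min (1 / 2) (\<kappa> / 4) * d \<le> \<kappa> / 4 * d"
    using \<kappa> d by (intro mult_right_mono) auto
  ultimately show ?thesis
    using loopless by linarith
next
  case False
  have "mean_degree n p i = p i i + loopless_mean_degree n p i"
    unfolding mean_degree_def loopless_mean_degree_def using i by (intro sum.remove) auto
  moreover have "p i i \<le> 1"
    using p i unfolding edge_probabilities_def by blast
  moreover have "min (1 / 2) (\<kappa> / 4) * d \<le> 1 / 2 * d"
    using False by (intro mult_right_mono) auto
  ultimately show ?thesis
    using d(1) False by linarith
qed

text \<open>A union bound over at most \<open>M + 1\<close> grid exponents. The conditions on
  \<open>T0\<close>, \<open>M\<close>, \<open>n\<close> and \<open>\<eta>\<close> do not mention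
  \<open>p\<close>, so the estimate is uniform over the regime.\<close>

lemma prob_degrees_close_ge:
  fixes \<epsilon> \<kappa> \<eta> \<delta> T0 :: real and M n :: nat
  defines "\<delta>' \<equiv> \<delta> / 6" and "c \<equiv> min (1 / 2) (\<kappa> / 4) / 2" and "l \<equiv> ln (real n)"
  assumes eps: "0 < \<epsilon>" "\<epsilon> < 1" and \<delta>: "0 < \<delta>" "\<delta> < 1" and \<kappa>: "0 < \<kappa>"
    and T0: "\<And>T. T0 \<le> T \<Longrightarrow> 1 < T \<and> T powr (- \<delta>' / 4) \<le> \<epsilon> * \<delta>' / 8 \<and> 1 \<le> ln T \<and>
      ln (2 / c) \<le> \<delta>' / 4 * ln T \<and> 2 / T \<le> \<delta>' * \<epsilon> / 16"
    and M: "2 / (\<delta>' * \<epsilon>) \<le> real M"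
    and n: "1 < n" "ln (l / \<kappa>) \<le> \<delta>' * \<epsilon> * l / 4" "8 \<le> exp (l * \<epsilon> * \<delta>' / 16)"
      "real n powr (- 1 / 2) \<le> 1 / 2" "l * real n powr (- 1 / 2) \<le> c * \<kappa> / 2"
      "(real M + 1) * (exp (- (l * \<epsilon> * \<delta>' / 8)) + exp (- (exp (l * \<epsilon> * \<delta>' / 16) / 8))) \<le> \<delta>"
    and \<eta>: "0 < \<eta>" "\<eta> \<le> 1 / 2" "T0 \<le> 1 / \<eta>"
    and regime: "regular_regime n \<kappa> \<eta> p"
  shows "1 - \<delta> \<le> measure_pmf.prob (random_graph n p) (degrees_close \<epsilon> n p \<delta>)"
proof -
  interpret inhomogeneous_graph n p
    using regime by unfold_locales (simp add: regular_regime_def)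
  define d where "d = max_mean_degree n p"
  define T where "T = l / d"
  have l: "0 < l"
    using n by (simp add: l_def)
  have d: "0 < d" "\<kappa> \<le> d" "d \<le> \<eta> * l" "\<And>i. i \<in> {1..n} \<Longrightarrow> mean_degree n p i = d"
    using regime \<kappa> by (auto simp: regular_regime_def d_def l_def)
  have \<delta>': "0 < \<delta>'" "\<delta>' < 1"
    using \<delta> by (auto simp: \<delta>'_def)
  have c: "0 < c"
    using \<kappa> by (simp add: c_def)
  have T_ge: "T0 \<le> T"
  proof -
    have "1 / \<eta> \<le> T"
      using \<eta>(1) d(1,3) by (simp add: T_def field_simps)
    then show ?thesis
      using \<eta>(3) by linarith
  qed
  \<comment> \<open>The lower bound \<open>\<kappa>\<close> on \<open>d\<close> keeps
    \<open>ln T\<close> of order at most \<open>ln l\<close>, far below \<open>l\<close>.\<close>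
  have "ln T \<le> ln (l / \<kappa>)"
    unfolding T_def using l d \<kappa> by (simp add: frac_le)
  then have lnT: "ln T \<le> \<delta>' * \<epsilon> * l / 4"
    using n by linarith
  have loopless: "2 * (c * d) \<le> loopless_mean_degree n p i" if "i \<in> {1..n}" for i
    using loopless_mean_degree_ge [of n p i \<kappa> d] that regime \<kappa> d by (auto simp: regular_regime_def c_def)
  \<comment> \<open>For \<open>\<eta> \<le> 1 / 2\<close> this dominates
    \<open>n powr (- 1 + \<eta>)\<close>, and \<open>l * q\<close> still tends to 0.\<close>
  define q where "q = real n powr (- 1 / 2)"
  have "real n powr (- 1 + \<eta>) \<le> q"
    unfolding q_def using n \<eta> by (intro powr_mono) auto
  moreover have "p_max n p \<le> real n powr (- 1 + \<eta>)"
    using regime by (simp add: regular_regime_def)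
  ultimately have "p_max n p \<le> q"
    by linarith
  with n have q: "p_max n p \<le> q" "0 \<le> q" "q \<le> 1 / 2"
    by (auto simp: q_def)
  have "c * \<kappa> / 2 \<le> c * d / 2"
    using c d by simp
  then have lq: "l * q \<le> c * d / 2"
    using n(5) unfolding q_def by linarith
  define J where "J = {j. j \<le> M \<and> real j / real M \<le> 1 - \<epsilon> / 2}"
  define U where "U j = {G. real n powr (j / M) \<le>
    real (card {i \<in> {1..n}. (1 + \<delta>') * ((1 - j / M) * l / ln T) \<le> real (degree n G i)})}" for j :: nat
  define W where "W j = {G.
    real (card {i \<in> {1..n}. (1 - \<delta>') * ((1 - j / M) * l / ln T) \<le> real (degree n G i)}) \<le>
    real n powr (j / M)}" for j :: nat
  define b where "b = exp (- (l * \<epsilon> * \<delta>' / 8)) + exp (- (exp (l * \<epsilon> * \<delta>' / 16) / 8))"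
  have J: "finite J" "card J \<le> M + 1"
  proof -
    have "J \<subseteq> {..M}"
      by (auto simp: J_def)
    then show "finite J" "card J \<le> M + 1"
      using finite_subset card_mono [of "{..M}" J] by auto
  qed
  have UW: "prob (U j \<union> W j) \<le> b" if j: "j \<in> J" for j
  proof -
    have lam: "\<epsilon> / 2 \<le> 1 - j / M" "1 - j / M \<le> 1"
      using j by (auto simp: J_def)
    have "prob (U j) \<le> exp (- (l * \<epsilon> * \<delta>' / 8))"
      using prob_upper_level [of d \<epsilon> \<delta>' "1 - j / M"] d(1,4) n(1) eps \<delta>' lam T0 [OF T_ge]
      by (simp add: U_def l_def T_def)
    moreover have "prob (W j) \<le> exp (- (exp (l * \<epsilon> * \<delta>' / 16) / 8))"
      using prob_lower_level [of d c q \<epsilon> \<delta>' "1 - j / M"] d(1,4) n(1,3) eps \<delta>' lam T0 [OF T_ge]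
        loopless c q lq lnT
      by (simp add: W_def l_def T_def)
    moreover have "prob (U j \<union> W j) \<le> prob (U j) + prob (W j)"
      by (rule measure_subadditive) auto
    ultimately show ?thesis
      by (simp add: b_def)
  qed
  define B where "B = (\<Union>j\<in>J. U j \<union> W j)"
  have "prob B \<le> (\<Sum>j\<in>J. prob (U j \<union> W j))"
    unfolding B_def using J by (intro measure_pmf.finite_measure_subadditive_finite) auto
  also have "\<dots> \<le> (\<Sum>j\<in>J. b)"
    using UW by (rule sum_mono)
  also have "\<dots> \<le> (real M + 1) * b"
    using J by (auto intro!: mult_right_mono simp: b_def)
  also have "\<dots> \<le> \<delta>"
    using n(6) by (simp add: b_def)
  finally have "prob B \<le> \<delta>" .
  moreover have "- B \<subseteq> degrees_close \<epsilon> n p \<delta>"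
  proof
    fix G assume "G \<in> - B"
    then have up: "\<And>j. j \<le> M \<Longrightarrow> real j / real M \<le> 1 - \<epsilon> / 2 \<Longrightarrow>
      real (card {i \<in> {1..n}. (1 + \<delta>') * ((1 - j / M) * l / ln T) \<le> real (degree n G i)}) < real n powr (j / M)"
      and low: "\<And>j. j \<le> M \<Longrightarrow> real j / real M \<le> 1 - \<epsilon> / 2 \<Longrightarrow>
      real n powr (j / M) < real (card {i \<in> {1..n}. (1 - \<delta>') * ((1 - j / M) * l / ln T) \<le> real (degree n G i)})"
      by (force simp: B_def U_def W_def J_def)+
    have "\<bar>L n p k / real (ordered_degree n G k) - 1\<bar> \<le> \<delta>"
      if "k \<in> {1..nat \<lfloor>real n powr (1 - \<epsilon>)\<rfloor>}" for k
    proof -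
      have k: "1 \<le> k" "real k \<le> real n powr (1 - \<epsilon>)"
        using that by (auto simp: le_nat_iff le_floor_iff)
      have L: "L n p k = ln (real n / real k) / ln T"
        by (simp add: L_def T_def d_def l_def)
      have "real n powr (1 - \<epsilon>) < real n powr 1"
        using n eps by (intro powr_less_mono) auto
      then have "real k < real n"
        using k n by simp
      then have L_pos: "0 < L n p k"
        unfolding L using k T0 [OF T_ge] by (intro divide_pos_pos) auto
      have "0 < ln T"
        using T0 [OF T_ge] by linarith
      then have "(1 - 2 * \<delta>') * L n p k \<le> real (ordered_degree n G k)"
        "real (ordered_degree n G k) \<le> (1 + 3 * \<delta>') * L n p k"
        unfolding L
        using ordered_degree_between [OF eps \<delta>' _ M n(1) k up [unfolded l_def] low [unfolded l_def]]
        by blast+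
      then show ?thesis
        using \<delta> L_pos by (intro ratio_close) (auto simp: \<delta>'_def)
    qed
    then show "G \<in> degrees_close \<epsilon> n p \<delta>"
      by (simp add: degrees_close_def close_event_def)
  qed
  then have "prob (- B) \<le> prob (degrees_close \<epsilon> n p \<delta>)"
    by (intro measure_pmf.finite_measure_mono) auto
  moreover have "prob (- B) = 1 - prob B"
    using measure_pmf.prob_compl [of B law] by (simp add: Compl_eq_Diff_UNIV)
  ultimately show ?thesis
    by (simp add: law_eq)
qed

text \<open>Order of choices: \<open>T0\<close> and \<open>M\<close> depend on
  \<open>\<epsilon>\<close>, \<open>\<delta>\<close> and \<open>\<kappa>\<close> only; then
  \<open>n\<close> is taken large in terms of \<open>M\<close>, and \<open>\<eta>\<close> small in
  terms of \<open>T0\<close>. The last two choices are independent, as the product filter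
  requires.\<close>

lemma eventually_prob_degrees_close_ge:
  fixes \<epsilon> \<kappa> \<delta> :: real
  assumes eps: "0 < \<epsilon>" "\<epsilon> < 1" and \<delta>: "0 < \<delta>" "\<delta> < 1" and \<kappa>: "0 < \<kappa>"
  shows "\<forall>\<^sub>F (n, \<eta>) in sequentially \<times>\<^sub>F at_right 0. \<forall>p. regular_regime n \<kappa> \<eta> p \<longrightarrow>
    1 - \<delta> \<le> measure_pmf.prob (random_graph n p) (degrees_close \<epsilon> n p \<delta>)"
proof -
  define \<delta>' where "\<delta>' = \<delta> / 6"
  define c where "c = min (1 / 2) (\<kappa> / 4) / 2"
  have \<delta>': "0 < \<delta>'"
    using \<delta> by (simp add: \<delta>'_def)
  have c: "0 < c"
    using \<kappa> by (simp add: c_def)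
  have "\<forall>\<^sub>F T in at_top. 1 < T \<and> T powr (- \<delta>' / 4) \<le> \<epsilon> * \<delta>' / 8 \<and> 1 \<le> ln T \<and>
      ln (2 / c) \<le> \<delta>' / 4 * ln T \<and> 2 / T \<le> \<delta>' * \<epsilon> / 16"
    using \<delta>' eps c by (intro eventually_conj; real_asymp)
  then obtain T0 where T0: "\<And>T. T0 \<le> T \<Longrightarrow> 1 < T \<and> T powr (- \<delta>' / 4) \<le> \<epsilon> * \<delta>' / 8 \<and> 1 \<le> ln T \<and>
      ln (2 / c) \<le> \<delta>' / 4 * ln T \<and> 2 / T \<le> \<delta>' * \<epsilon> / 16"
    unfolding eventually_at_top_linorder by blast
  obtain M :: nat where M: "2 / (\<delta>' * \<epsilon>) \<le> real M"
    using real_arch_simple by blast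
  have n: "\<forall>\<^sub>F n :: nat in sequentially. 1 < n \<and>
      ln (ln (real n) / \<kappa>) \<le> \<delta>' * \<epsilon> * ln (real n) / 4 \<and> 8 \<le> exp (ln (real n) * \<epsilon> * \<delta>' / 16) \<and>
      real n powr (- 1 / 2) \<le> 1 / 2 \<and> ln (real n) * real n powr (- 1 / 2) \<le> c * \<kappa> / 2 \<and>
      (real M + 1) * (exp (- (ln (real n) * \<epsilon> * \<delta>' / 8)) + exp (- (exp (ln (real n) * \<epsilon> * \<delta>' / 16) / 8))) \<le> \<delta>"
  proof (intro eventually_conj)
    show "\<forall>\<^sub>F n :: nat in sequentially. 1 < n"
      by (rule eventually_gt_at_top)
    show "\<forall>\<^sub>F n :: nat in sequentially. ln (ln (real n) / \<kappa>) \<le> \<delta>' * \<epsilon> * ln (real n) / 4"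
      using \<delta>' eps \<kappa> by real_asymp
    show "\<forall>\<^sub>F n :: nat in sequentially. 8 \<le> exp (ln (real n) * \<epsilon> * \<delta>' / 16)"
      using \<delta>' eps by real_asymp
    show "\<forall>\<^sub>F n :: nat in sequentially. real n powr (- 1 / 2) \<le> 1 / 2"
      by real_asymp
    show "\<forall>\<^sub>F n :: nat in sequentially. ln (real n) * real n powr (- 1 / 2) \<le> c * \<kappa> / 2"
      using c \<kappa> by real_asymp
    have "(\<lambda>n :: nat. (real M + 1) * (exp (- (ln (real n) * \<epsilon> * \<delta>' / 8)) +
        exp (- (exp (ln (real n) * \<epsilon> * \<delta>' / 16) / 8)))) \<longlonglongrightarrow> (real M + 1) * (0 + 0)"
      using \<delta>' eps by (intro tendsto_intros; real_asymp)
    then have "\<forall>\<^sub>F n :: nat in sequentially. (real M + 1) * (exp (- (ln (real n) * \<epsilon> * \<delta>' / 8)) +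
        exp (- (exp (ln (real n) * \<epsilon> * \<delta>' / 16) / 8))) < \<delta>"
      using \<delta> by (intro order_tendstoD(2)) auto
    then show "\<forall>\<^sub>F n :: nat in sequentially. (real M + 1) * (exp (- (ln (real n) * \<epsilon> * \<delta>' / 8)) +
        exp (- (exp (ln (real n) * \<epsilon> * \<delta>' / 16) / 8))) \<le> \<delta>"
      by eventually_elim simp
  qed
  have \<eta>: "\<forall>\<^sub>F \<eta> in at_right (0::real). 0 < \<eta> \<and> \<eta> \<le> 1 / 2 \<and> T0 \<le> 1 / \<eta>"
    by (intro eventually_conj; real_asymp)
  show ?thesis
    using eventually_prodI [OF n \<eta>]
  proof eventually_elim
    case (elim z)
    obtain n \<eta> where z: "z = (n, \<eta>)"
      by (cases z)
    show ?case
      unfolding z prod.case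
    proof (intro allI impI)
      fix p assume "regular_regime n \<kappa> \<eta> p"
      then show "1 - \<delta> \<le> measure_pmf.prob (random_graph n p) (degrees_close \<epsilon> n p \<delta>)"
        using elim T0 M eps \<delta> \<kappa> unfolding z \<delta>'_def c_def
        by (intro prob_degrees_close_ge [of \<epsilon> \<delta> \<kappa> T0 M n \<eta> p]) auto
    qed
  qed
qed

text \<open>The error function is essentially the best accuracy \<open>\<delta>\<close> valid for
  all \<open>p\<close> in the regime at once. It tends to 0 because every fixed
  \<open>\<delta>\<close> is eventually valid.\<close>

theorem corollary1p13:
  fixes \<epsilon> :: real
  assumes "0 < \<epsilon>" and "\<epsilon> < 1"
  shows "\<exists>\<psi>. admissible_error \<psi> \<and>
    (\<forall>(n::nat) (\<kappa>::real) (\<eta>::real) (p :: nat \<Rightarrow> nat \<Rightarrow> real).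
      n \<ge> 1 \<longrightarrow> \<kappa> > 0 \<longrightarrow> 0 < \<eta> \<longrightarrow> \<eta> < 1 \<longrightarrow> edge_probabilities n p \<longrightarrow>
      (\<forall>i\<in>{1..n}. mean_degree n p i = max_mean_degree n p) \<longrightarrow>
      \<kappa> \<le> max_mean_degree n p \<longrightarrow>
      max_mean_degree n p \<le> \<eta> * ln (real n) \<longrightarrow>
      p_max n p \<le> real n powr (- 1 + \<eta>) \<longrightarrow>
      (\<forall>i\<in>{1..n}. \<kappa> / 2 \<le> loopless_mean_degree n p i) \<longrightarrow>
      measure_pmf.prob (random_graph n p)
        (close_event {1..nat \<lfloor>real n powr (1 - \<epsilon>)\<rfloor>}
           (\<lambda>k G. real (ordered_degree n G k)) (\<lambda>k G. L n p k) (\<psi> n \<kappa> \<eta>))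
        \<ge> 1 - \<psi> n \<kappa> \<eta>)"
proof -
  \<comment> \<open>The accuracy 1 always belongs to \<open>Q\<close>, as its probability bound is
    trivial, so the infimum is over a nonempty set.\<close>
  define Q where "Q n \<kappa> \<eta> = {\<delta>. 0 \<le> \<delta> \<and> (\<forall>p. regular_regime n \<kappa> \<eta> p \<longrightarrow>
    1 - \<delta> \<le> measure_pmf.prob (random_graph n p) (degrees_close \<epsilon> n p \<delta>))}" for n \<kappa> \<eta>
  \<comment> \<open>The summand \<open>1 / Suc n\<close> is there because the infimum need not be attained.\<close>
  define \<psi> where "\<psi> n \<kappa> \<eta> = Inf (Q n \<kappa> \<eta>) + 1 / real (Suc n)" for n \<kappa> \<eta>
  have one: "1 \<in> Q n \<kappa> \<eta>" for n \<kappa> \<eta>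
    by (simp add: Q_def)
  have bdd: "bdd_below (Q n \<kappa> \<eta>)" for n \<kappa> \<eta>
    by (rule bdd_belowI [of _ 0]) (simp add: Q_def)
  have Inf_nonneg: "0 \<le> Inf (Q n \<kappa> \<eta>)" for n \<kappa> \<eta>
  proof (rule cInf_greatest)
    show "Q n \<kappa> \<eta> \<noteq> {}"
      using one by blast
  qed (simp add: Q_def)
  have "admissible_error \<psi>"
    unfolding admissible_error_def
  proof (intro allI impI tendstoI)
    fix \<kappa> r :: real assume \<kappa>: "0 < \<kappa>" and r: "0 < r"
    define \<delta> where "\<delta> = min (r / 2) (1 / 2)"
    have "\<forall>\<^sub>F n in sequentially. 1 / real (Suc n) < r / 2"
      using r by real_asymp
    then have "\<forall>\<^sub>F (n, \<eta>) in sequentially \<times>\<^sub>F at_right (0::real). 1 / real (Suc n) < r / 2"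
      using eventually_prodI [of _ sequentially "\<lambda>_. True" "at_right (0::real)"]
      by (auto simp: case_prod_beta')
    moreover have "\<forall>\<^sub>F (n, \<eta>) in sequentially \<times>\<^sub>F at_right 0. \<forall>p. regular_regime n \<kappa> \<eta> p \<longrightarrow>
        1 - \<delta> \<le> measure_pmf.prob (random_graph n p) (degrees_close \<epsilon> n p \<delta>)"
      using assms r \<kappa> by (intro eventually_prob_degrees_close_ge) (auto simp: \<delta>_def)
    ultimately show "\<forall>\<^sub>F z in sequentially \<times>\<^sub>F at_right 0. dist (case z of (n, \<eta>) \<Rightarrow> \<psi> n \<kappa> \<eta>) 0 < r"
    proof eventually_elim
      case (elim z)
      obtain n \<eta> where z: "z = (n, \<eta>)"
        by (cases z)
      have "\<delta> \<in> Q n \<kappa> \<eta>"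
        using elim r by (auto simp: z Q_def \<delta>_def)
      then have "Inf (Q n \<kappa> \<eta>) \<le> r / 2"
        using bdd cInf_lower [of \<delta> "Q n \<kappa> \<eta>"] by (simp add: \<delta>_def)
      then show ?case
        using elim Inf_nonneg [of n \<kappa> \<eta>] by (simp add: z \<psi>_def)
    qed
  qed
  moreover have "1 - \<psi> n \<kappa> \<eta> \<le> measure_pmf.prob (random_graph n p) (degrees_close \<epsilon> n p (\<psi> n \<kappa> \<eta>))"
    if "regular_regime n \<kappa> \<eta> p" for n \<kappa> \<eta> p
  proof -
    have "\<exists>\<delta>\<in>Q n \<kappa> \<eta>. \<delta> < \<psi> n \<kappa> \<eta>"
    proof (rule cInf_lessD)
      show "Q n \<kappa> \<eta> \<noteq> {}"
        using one by blast
    qed (simp add: \<psi>_def)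
    then obtain \<delta> where \<delta>: "\<delta> \<in> Q n \<kappa> \<eta>" "\<delta> < \<psi> n \<kappa> \<eta>"
      by blast
    \<comment> \<open>Enlarging the accuracy enlarges the event and weakens the required
      probability, so validity passes from \<open>\<delta>\<close> to
      \<open>\<psi> n \<kappa> \<eta>\<close>.\<close>
    have "degrees_close \<epsilon> n p \<delta> \<subseteq> degrees_close \<epsilon> n p (\<psi> n \<kappa> \<eta>)"
      using \<delta>(2) by (fastforce simp: degrees_close_def close_event_def)
    then have "measure_pmf.prob (random_graph n p) (degrees_close \<epsilon> n p \<delta>) \<le>
        measure_pmf.prob (random_graph n p) (degrees_close \<epsilon> n p (\<psi> n \<kappa> \<eta>))"
      by (intro measure_pmf.finite_measure_mono) auto
    moreover have "1 - \<delta> \<le> measure_pmf.prob (random_graph n p) (degrees_close \<epsilon> n p \<delta>)"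
      using \<delta>(1) that by (simp add: Q_def)
    ultimately show ?thesis
      using \<delta>(2) by linarith
  qed
  ultimately show ?thesis
    unfolding degrees_close_def regular_regime_def by blast
qed

end
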